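(* Let $\{\vec{x}_i,\vec{y}_i\}_{i\in[N]}$ be a given dataset with $\vec{x}_i\in\mathbb{R}^d$ and $\vec{y}_i\in[m]$. Let $\lambda>0$ be fixed, and let $\mathfrak{Q}:\mathbb{R}^d\to\mathbb{R}^d$ be a non-zero affine map such that $\mathfrak{Q}\vec{x}_i\geqslant0$ (componentwise) for all $i\in[N]$. Set $\mathbf{x}^0_i:=\mathfrak{Q}\vec{x}_i$ for $i\in[N]$, and let $P\in\mathbb{R}^{m\times d}$ be any non-zero matrix such that the ReLU system $$\dot{\mathbf{x}}_i(t)=\sigma\big(w(t)\mathbf{x}_i(t)+b(t)\big)\ \text{ in }(0,T_0),\qquad \mathbf{x}_i(0)=\mathbf{x}^0_i,\qquad i\in[N],\qquad \sigma(x)=\max\{x,0\},$$ separates the dataset $\{\mathbf{x}^0_i,\vec{y}_i\}_{i\in[N]}$ with respect to $P$ in some time $T_0>0$, and let $\gamma>0$ denote the associated margin (i.e. the margin at time $T_0$ of the separating parameters). For any $T\geqslant T_0$, let $[w_T,b_T]\in H^1(0,T;\mathbb{R}^{d_u})$ be any pair of global minimizers of $$J_{\lambda,T}(w,b)=\mathscr{E}(\mathbf{x}(T))+\lambda\big\|[w,b]\big\|^2_{H^1(0,T;\mathbb{R}^{d_u})},\qquad \mathscr{E}(\mathbf{x})=\frac1N\sum_{i=1}^N-\log\left(\frac{e^{(P\mathbf{x}_i)_{\vec{y}_i}}}{\sum_{j=1}^m e^{(P\mathbf{x}_i)_j}}\right),$$ where $\mathbf{x}=(\mathbf{x}_1,\dots,\mathbf{x}_N)$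 is the solution of the ReLU system on $[0,T]$ with parameters $[w,b]$ and initial data $\mathbf{x}^0_i$, and let $\mathbf{x}_T(\cdot)$ be the unique solution associated to $[w_T,b_T]$. Then there exists a constant $\mathfrak{C}=\mathfrak{C}(\{\vec{x}_i,\vec{y}_i\}_{i\in[N]},\lambda)>0$ independent of $T>0$ such that $$\mathscr{E}(\mathbf{x}_T(T))\leqslant\log\left(1+(m-1)e^{-\gamma\,e^{\frac{T^\alpha}{2}}}\right)+\mathfrak{C}\,T^{2\alpha-1}$$ holds for any $\alpha\in\left(0,\tfrac12\right)$.
   Context: Write $[n]=\{1,\dots,n\}$; $m\geqslant2$ is the number of classes, and $\vec{x}_i\neq\vec{x}_j$ for $i\neq j$. $\mathbb{R}^{d_u}:=\mathbb{R}^{d\times(d+1)}$; its elements are pairs $[w,b]$ with $w\in\mathbb{R}^{d\times d}$, $b\in\mathbb{R}^d$. $\sigma$ acts componentwise on vectors. $\|f\|_{H^1}^2=\|f\|_{L^2}^2+\|\dot f\|_{L^2}^2$. Separation: the system above separates the dataset $\{\mathbf{x}_i^0,\vec{y}_i\}_{i\in[N]}$ with respect to $P$ in time $T_0$ if there exist parameters $[w,b]\in H^1(0,T_0;\mathbb{R}^{d_u})$ such that the corresponding solution satisfies $(P\mathbf{x}_i(T_0))_{\vec{y}_i}-\max_{j\in[m],\,j\neq\vec{y}_i}(P\mathbf{x}_i(T_0))_j>0$ for all $i\in[N]$. The corresponding margin is $$\gamma=\min_{i\in[N]}\Big((P\mathbf{x}_i(T_0))_{\vec{y}_i}-\max_{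j\in[m],\,j\neq\vec{y}_i}(P\mathbf{x}_i(T_0))_j\Big).$$
   Formalization: The constant C may depend on Q, P, T_0 and the separating parameters as well as on the dataset and λ (it is independent of T, of the minimizer and of α); a constant depending only on the dataset and λ is impossible, e.g. N=d=1, m=2, P=(ε,0) with ε→0. *)

theory Defs
  imports "HOL-Analysis.Analysis"
begin

definition square_integrable :: "real \<Rightarrow> real \<Rightarrow> (real \<Rightarrow> 'a::euclidean_space) \<Rightarrow> bool" where
  "square_integrable a b f \<longleftrightarrow>
     f \<in> borel_measurable (lebesgue_on {a<..<b}) \<and>
     integrable (lebesgue_on {a<..<b}) (\<lambda>t. (norm (f t))\<^sup>2)"

text \<open>Test functions are \<open>C\<^sup>1\<close> with support in the open interval (hence compact), as in
  Brezis' treatment of Sobolev spaces in one dimension; \<open>C\<^sup>\<infinity>\<close> test functions give the same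
  weak derivative.\<close>

definition test_function :: "real \<Rightarrow> real \<Rightarrow> (real \<Rightarrow> real) \<Rightarrow> bool" where
  "test_function a b \<phi> \<longleftrightarrow>
     \<phi> C1_differentiable_on UNIV \<and> closure {t. \<phi> t \<noteq> 0} \<subseteq> {a<..<b}"

definition is_weak_deriv ::
  "real \<Rightarrow> real \<Rightarrow> (real \<Rightarrow> 'a::euclidean_space) \<Rightarrow> (real \<Rightarrow> 'a) \<Rightarrow> bool" where
  "is_weak_deriv a b f g \<longleftrightarrow>
     (\<forall>\<phi>. test_function a b \<phi> \<longrightarrow>
        (\<integral>t. deriv \<phi> t *\<^sub>R f t \<partial>lebesgue_on {a<..<b}) =
        - (\<integral>t. \<phi> t *\<^sub>R g t \<partial>lebesgue_on {a<..<b}))"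

text \<open>An element of \<open>H\<^sup>1(a,b)\<close> is represented by its continuous representative on \<open>[a,b]\<close>
  (values outside \<open>[a,b]\<close> are irrelevant), so that the differential equation below can be
  required at every time.\<close>

definition H1 :: "real \<Rightarrow> real \<Rightarrow> (real \<Rightarrow> 'a::euclidean_space) set" where
  "H1 a b = {f. continuous_on {a..b} f \<and> square_integrable a b f \<and>
                (\<exists>g. square_integrable a b g \<and> is_weak_deriv a b f g)}"

text \<open>The weak derivative is unique almost everywhere on \<open>(a,b)\<close>, so the norm does not depend
  on the choice.\<close>

definition weak_deriv ::
  "real \<Rightarrow> real \<Rightarrow> (real \<Rightarrow> 'a::euclidean_space) \<Rightarrow> real \<Rightarrow> 'a" where
  "weak_deriv a b f = (SOME g. square_integrable a b g \<and> is_weak_deriv a b f g)"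

definition H1_norm :: "real \<Rightarrow> real \<Rightarrow> (real \<Rightarrow> 'a::euclidean_space) \<Rightarrow> real" where
  "H1_norm a b f =
     sqrt ((\<integral>t. (norm (f t))\<^sup>2 \<partial>lebesgue_on {a<..<b}) +
           (\<integral>t. (norm (weak_deriv a b f t))\<^sup>2 \<partial>lebesgue_on {a<..<b}))"

text \<open>A parameter value is a pair \<open>[w,b]\<close>; the product norm on this type is the Euclidean norm
  of the \<open>d \<times> (d+1)\<close> array.\<close>

type_synonym 'd param = "(real^'d^'d) \<times> (real^'d)"

definition relu :: "real^'d \<Rightarrow> real^'d" where
  "relu v = (\<chi> k. max (v $ k) 0)"

definition relu_system ::
  "real \<Rightarrow> (real \<Rightarrow> ('d::finite) param) \<Rightarrow> ('n \<Rightarrow> real^'d) \<Rightarrow> ('n \<Rightarrow> real \<Rightarrow> real^'d) \<Rightarrow> bool" where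
  "relu_system T u x0 x \<longleftrightarrow>
     (\<forall>i. continuous_on {0..T} (x i) \<and> x i 0 = x0 i \<and>
          (\<forall>t\<in>{0<..<T}.
             (x i has_vector_derivative relu (fst (u t) *v x i t + snd (u t))) (at t)))"

definition class_gap :: "real^'d^'m \<Rightarrow> real^'d \<Rightarrow> 'm::finite \<Rightarrow> real" where
  "class_gap P z k = (P *v z) $ k - Max ((\<lambda>j. (P *v z) $ j) ` {j. j \<noteq> k})"

text \<open>The dataset is separated in time \<open>T\<close> iff this holds for some \<open>u\<close> and \<open>x\<close>.\<close>

definition separates_by ::
  "real \<Rightarrow> real^('d::finite)^('m::finite) \<Rightarrow> ('n \<Rightarrow> real^'d) \<Rightarrow> ('n \<Rightarrow> 'm) \<Rightarrow>
   (real \<Rightarrow> 'd param) \<Rightarrow> ('n \<Rightarrow> real \<Rightarrow> real^'d) \<Rightarrow> bool" where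
  "separates_by T P x0 y u x \<longleftrightarrow>
     u \<in> H1 0 T \<and> relu_system T u x0 x \<and> (\<forall>i. class_gap P (x i T) (y i) > 0)"

definition margin ::
  "real^('d::finite)^('m::finite) \<Rightarrow> ('n::finite \<Rightarrow> 'm) \<Rightarrow> ('n \<Rightarrow> real^'d) \<Rightarrow> real" where
  "margin P y z = Min (range (\<lambda>i. class_gap P (z i) (y i)))"

definition training_error ::
  "real^('d::finite)^('m::finite) \<Rightarrow> ('n::finite \<Rightarrow> 'm) \<Rightarrow> ('n \<Rightarrow> real^'d) \<Rightarrow> real" where
  "training_error P y z =
     1 / real CARD('n) *
       (\<Sum>i\<in>UNIV. - ln (exp ((P *v z i) $ y i) / (\<Sum>j\<in>UNIV. exp ((P *v z i) $ j))))"

text \<open>For \<open>u \<in> H\<^sup>1(0,T)\<close> the ReLU system has exactly one solution on \<open>[0,T]\<close> (its right-hand side is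
  continuous in time and globally Lipschitz in the state); it is passed explicitly as \<open>x\<close>,
  and minimization runs over all pairs of a parameter and its solution.\<close>

definition J_cost ::
  "real \<Rightarrow> real \<Rightarrow> real^('d::finite)^('m::finite) \<Rightarrow> ('n::finite \<Rightarrow> 'm) \<Rightarrow>
   (real \<Rightarrow> 'd param) \<Rightarrow> ('n \<Rightarrow> real \<Rightarrow> real^'d) \<Rightarrow> real" where
  "J_cost lam T P y u x = training_error P y (\<lambda>i. x i T) + lam * (H1_norm 0 T u)\<^sup>2"

definition global_minimizer ::
  "real \<Rightarrow> real \<Rightarrow> real^('d::finite)^('m::finite) \<Rightarrow> ('n::finite \<Rightarrow> real^'d) \<Rightarrow> ('n \<Rightarrow> 'm) \<Rightarrow>
   (real \<Rightarrow> 'd param) \<Rightarrow> ('n \<Rightarrow> real \<Rightarrow> real^'d) \<Rightarrow> bool" where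
  "global_minimizer lam T P x0 y u x \<longleftrightarrow>
     u \<in> H1 0 T \<and> relu_system T u x0 x \<and>
     (\<forall>v z. v \<in> H1 0 T \<and> relu_system T v x0 z \<longrightarrow> J_cost lam T P y u x \<le> J_cost lam T P y v z)"

end

theory Submission
  imports Defs
begin

text \<open>A global minimizer costs at most as much as any competitor. The competitor follows the separating
  trajectory \<open>z0\<close> on \<open>[0, T/2]\<close> in the slowed-down time \<open>\<theta>\<close>, with parameters \<open>\<theta>' \<cdot> (u0 \<circ> \<theta>)\<close>
  (the ReLU is positively homogeneous), and then, with parameters \<open>[c(t) I, 0]\<close>, multiplies the
  states by \<open>exp (\<integral>c) = exp (T\<^sup>\<alpha> / 2)\<close>; this is possible because the states are nonnegative. The final
  margin is \<open>\<gamma> exp (T\<^sup>\<alpha> / 2)\<close>. The first phase has squared \<open>H\<^sup>1\<close> norm \<open>O(1/T)\<close> and the second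
  \<open>O(T\<^bsup>2\<alpha> - 1\<^esup>)\<close>. Choosing \<open>\<theta>'\<close> and \<open>c\<close> to be \<open>C\<^sup>1\<close> functions vanishing at \<open>T/2\<close> keeps the
  competitor in \<open>H\<^sup>1\<close>.\<close>

text \<open>The separating parameters \<open>u0\<close> are merely in H1, so the chain rule for
  \<open>u0\<close> along the slowed time must be proved for weak derivatives, and along a \<theta>
  whose derivative vanishes at T/2. The way around is to identify weak derivatives with densities of
  indefinite integrals: testing with approximate indicators gives the fundamental theorem, Fubini
  gives its converse, and the substitution takes place between the two. The same identification
  yields uniqueness almost everywhere, without which the norm, defined through a chosen weak
  derivative, could not be evaluated.

  The scales are forced: growth by exp(T^\<alpha>/2) within a time T/2 needs c of size
  T^(\<alpha>-1), whose square integrates to order T^(2\<alpha>-1). The order 1/T of the first phase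
  is then absorbed, because T^(2\<alpha>) is bounded below for T \<ge> T0 by a constant that does
  not depend on \<alpha>; so one constant serves all \<alpha> at once.\<close>

section \<open>Integrals over an open interval, powers of the positive part, approximate
  identities\<close>

lemma integrable_lebesgue_on_Ioo:
  fixes f :: "real \<Rightarrow> 'a::euclidean_space"
  assumes "continuous_on {a..b} f"
  shows "integrable (lebesgue_on {a<..<b}) f"
proof -
  have "set_integrable lebesgue {a..b} f"
    using continuous_imp_integrable_real[OF assms]
    by (simp add: integrable_restrict_space set_integrable_def)
  then have "set_integrable lebesgue {a<..<b} f"
    by (rule set_integrable_subset) auto
  then show ?thesis
    by (rule absolutely_integrable_imp_integrable) auto
qed

lemma integral_lebesgue_on_Ioo:
  fixes f :: "real \<Rightarrow> 'a::euclidean_space"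
  assumes "continuous_on {a..b} f"
  shows "(\<integral>t. f t \<partial>lebesgue_on {a<..<b}) = integral {a..b} f"
  using lebesgue_integral_eq_integral[OF integrable_lebesgue_on_Ioo[OF assms]]
  by (simp add: integral_open_interval_real)

lemma integral_derivative_lebesgue_on_Ioo:
  fixes f :: "real \<Rightarrow> 'a::euclidean_space"
  assumes "a \<le> b" "\<And>t. t \<in> {a..b} \<Longrightarrow> (f has_vector_derivative f' t) (at t within {a..b})"
    and "continuous_on {a..b} f'"
  shows "(\<integral>t. f' t \<partial>lebesgue_on {a<..<b}) = f b - f a"
  using fundamental_theorem_of_calculus[OF assms(1,2)] integral_lebesgue_on_Ioo[OF assms(3)]
  by (simp add: integral_unique)

text \<open>Only the kink at 0 needs an argument: there the difference quotient is
  \<open>max 0 z ^ Suc n\<close>, continuous with value 0, so Caratheodory's criterion applies. All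
  C1 functions below, both the cutoffs and the profiles of the competitor, are assembled from these
  powers.\<close>

lemma has_real_derivative_pos_part_power:
  "((\<lambda>x. max 0 x ^ Suc (Suc n)) has_real_derivative real (n + 2) * max 0 x ^ Suc n) (at x)"
proof -
  consider "x < 0" | "x = 0" | "x > 0" by linarith
  then show ?thesis
  proof cases
    case 1
    have "((\<lambda>x::real. 0) has_real_derivative 0) (at x)" by simp
    then have "((\<lambda>x. max 0 x ^ Suc (Suc n)) has_real_derivative 0) (at x)"
      by (rule has_field_derivative_transform_within_open[where S="{..<0}"]) (use 1 in auto)
    with 1 show ?thesis by simp
  next
    case 2
    have "isCont (\<lambda>z::real. max 0 z ^ Suc n) 0" by (intro continuous_intros)
    moreover have "max 0 z ^ Suc (Suc n) - max 0 0 ^ Suc (Suc n) = max 0 z ^ Suc n * (z - 0)" for z :: real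
      by (auto simp: max_def)
    ultimately have "((\<lambda>x. max 0 x ^ Suc (Suc n)) has_real_derivative 0) (at 0)"
      unfolding CARAT_DERIV by (intro exI[of _ "\<lambda>z::real. max 0 z ^ Suc n"]) auto
    with 2 show ?thesis by simp
  next
    case 3
    have "((\<lambda>x::real. x ^ Suc (Suc n)) has_real_derivative real (n + 2) * x ^ Suc n) (at x)"
      by (rule derivative_eq_intros refl | simp)+
    then have "((\<lambda>x. max 0 x ^ Suc (Suc n)) has_real_derivative real (n + 2) * x ^ Suc n) (at x)"
      by (rule has_field_derivative_transform_within_open[where S="{0<..}"]) (use 3 in auto)
    with 3 show ?thesis by simp
  qed
qed

text \<open>Nonnegative kernels of mass 1 average \<open>f\<close> over shrinking neighbourhoods of
  \<open>c\<close>. The kernels have to satisfy this only eventually, since the cutoffs used later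
  fit into their interval only for large \<open>n\<close>. The point \<open>c\<close> may be an
  endpoint of the interval, because a kernel may put all its mass on one side.\<close>

lemma tendsto_integral_approximate_identity:
  fixes f :: "real \<Rightarrow> 'a::euclidean_space" and k :: "nat \<Rightarrow> real \<Rightarrow> real"
  assumes f: "continuous_on {a..b} f" and c: "c \<in> {a..b}" and d: "d \<longlonglongrightarrow> 0"
    and k: "\<forall>\<^sub>F n in sequentially. continuous_on {a..b} (k n) \<and>
          (\<forall>t\<in>{a..b}. k n t \<ge> 0 \<and> (k n t \<noteq> 0 \<longrightarrow> \<bar>t - c\<bar> \<le> d n)) \<and>
          (\<integral>t. k n t \<partial>lebesgue_on {a<..<b}) = 1"
  shows "(\<lambda>n. \<integral>t. k n t *\<^sub>R f t \<partial>lebesgue_on {a<..<b}) \<longlonglongrightarrow> f c"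
proof (rule tendstoI)
  fix e :: real assume "e > 0"
  then obtain r where r: "r > 0" "\<And>t. t \<in> {a..b} \<Longrightarrow> dist t c < r \<Longrightarrow> dist (f t) (f c) < e / 2"
    using f c unfolding continuous_on_iff by (metis half_gt_zero)
  have "\<forall>\<^sub>F n in sequentially. d n < r" using d r(1) by (rule order_tendstoD)
  then show "\<forall>\<^sub>F n in sequentially. dist (\<integral>t. k n t *\<^sub>R f t \<partial>lebesgue_on {a<..<b}) (f c) < e"
    using k
  proof eventually_elim
    case (elim n)
    have int1: "integrable (lebesgue_on {a<..<b}) (\<lambda>t. k n t *\<^sub>R f t)"
      and int2: "integrable (lebesgue_on {a<..<b}) (\<lambda>t. k n t *\<^sub>R f c)"
      and int3: "integrable (lebesgue_on {a<..<b}) (\<lambda>t. k n t *\<^sub>R (f t - f c))"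
      and int4: "integrable (lebesgue_on {a<..<b}) (\<lambda>t. k n t * (e / 2))"
      and int5: "integrable (lebesgue_on {a<..<b}) (k n)"
      using elim f by (auto intro!: integrable_lebesgue_on_Ioo continuous_intros)
    have "(\<integral>t. k n t *\<^sub>R f t \<partial>lebesgue_on {a<..<b}) - f c
        = (\<integral>t. k n t *\<^sub>R f t \<partial>lebesgue_on {a<..<b}) - (\<integral>t. k n t *\<^sub>R f c \<partial>lebesgue_on {a<..<b})"
      using elim int5 by simp
    also have "\<dots> = (\<integral>t. k n t *\<^sub>R (f t - f c) \<partial>lebesgue_on {a<..<b})"
      by (subst Bochner_Integration.integral_diff[OF int1 int2, symmetric]) (simp add: scaleR_diff_right)
    also have "norm \<dots> \<le> (\<integral>t. norm (k n t *\<^sub>R (f t - f c)) \<partial>lebesgue_on {a<..<b})"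
      by (rule integral_norm_bound)
    finally have "norm ((\<integral>t. k n t *\<^sub>R f t \<partial>lebesgue_on {a<..<b}) - f c)
       \<le> (\<integral>t. norm (k n t *\<^sub>R (f t - f c)) \<partial>lebesgue_on {a<..<b})" .
    also have "\<dots> \<le> (\<integral>t. k n t * (e / 2) \<partial>lebesgue_on {a<..<b})"
    proof (rule integral_mono)
      show "integrable (lebesgue_on {a<..<b}) (\<lambda>t. norm (k n t *\<^sub>R (f t - f c)))"
        using int3 by (rule integrable_norm)
      fix t assume "t \<in> space (lebesgue_on {a<..<b})"
      then have t: "t \<in> {a..b}" by auto
      show "norm (k n t *\<^sub>R (f t - f c)) \<le> k n t * (e / 2)"
      proof (cases "k n t = 0")
        case False
        then have "dist (f t) (f c) < e / 2"
          using elim t r(2)[of t] by (force simp: dist_real_def)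
        then have "norm (f t - f c) \<le> e / 2" by (simp add: dist_norm)
        moreover have "k n t \<ge> 0" using elim t by blast
        ultimately show ?thesis using mult_left_mono[of "norm (f t - f c)" "e / 2" "k n t"] by simp
      qed simp
    qed fact
    also have "\<dots> = e / 2" using elim by simp
    finally show ?case using \<open>e > 0\<close> by (simp add: dist_norm)
  qed
qed

section \<open>Weak derivatives on an interval\<close>

text \<open>The antiderivative of the tent \<open>hat\<close> on [0, 2], which has area 1: a
  quadratic spline that rises from 0 to 1 across that interval.\<close>

definition ramp :: "real \<Rightarrow> real" where
  "ramp x = (max 0 x ^ 2 - 2 * max 0 (x - 1) ^ 2 + max 0 (x - 2) ^ 2) / 2"

definition hat :: "real \<Rightarrow> real" where
  "hat x = max 0 x - 2 * max 0 (x - 1) + max 0 (x - 2)"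

lemma ramp_deriv: "(ramp has_real_derivative hat x) (at x)"
proof -
  have D: "((\<lambda>x. max 0 (x - c) ^ 2) has_real_derivative 2 * max 0 (x - c)) (at x)" for c x :: real
    using DERIV_chain2[where f = "\<lambda>y. max 0 y ^ 2" and g = "\<lambda>x. x - c" and x = x and s = UNIV and Db = 1,
        OF has_real_derivative_pos_part_power[of 0, folded numeral_2_eq_2]]
    by (simp add: DERIV_diff[where E=0, simplified])
  have "((\<lambda>x. (max 0 (x - 0) ^ 2 - 2 * max 0 (x - 1) ^ 2 + max 0 (x - 2) ^ 2) / 2) has_real_derivative
      (2 * max 0 (x - 0) - 2 * (2 * max 0 (x - 1)) + 2 * max 0 (x - 2)) / 2) (at x)"
    by (intro DERIV_cdivide DERIV_add DERIV_diff DERIV_cmult D)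
  moreover have "ramp = (\<lambda>x. (max 0 (x - 0) ^ 2 - 2 * max 0 (x - 1) ^ 2 + max 0 (x - 2) ^ 2) / 2)"
    by (simp add: ramp_def fun_eq_iff)
  moreover have "(2 * max 0 (x - 0) - 2 * (2 * max 0 (x - 1)) + 2 * max 0 (x - 2)) / 2 = hat x"
    by (simp add: hat_def)
  ultimately show ?thesis by simp
qed

lemma ramp_eq_0: "x \<le> 0 \<Longrightarrow> ramp x = 0" by (simp add: ramp_def)

lemma ramp_eq_1: "x \<ge> 2 \<Longrightarrow> ramp x = 1"
  by (simp add: ramp_def power2_eq_square field_simps)

lemma continuous_on_hat: "continuous_on A hat"
  unfolding hat_def by (intro continuous_intros)

lemma hat_nonneg: "hat x \<ge> 0" by (auto simp: hat_def max_def)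

lemma hat_eq_0: "x \<le> 0 \<or> x \<ge> 2 \<Longrightarrow> hat x = 0" by (auto simp: hat_def max_def)

lemma ramp_bounds: "0 \<le> ramp x" "ramp x \<le> 1"
proof -
  have mono: "ramp u \<le> ramp v" if "u \<le> v" for u v
    using that by (rule DERIV_nonneg_imp_nondecreasing) (use ramp_deriv hat_nonneg in blast)
  show "0 \<le> ramp x" using mono[of 0 x] ramp_eq_0[of 0] ramp_eq_0[of x] by (cases "x \<le> 0") auto
  show "ramp x \<le> 1" using mono[of x 2] ramp_eq_1[of 2] ramp_eq_1[of x] by (cases "x \<ge> 2") auto
qed

text \<open>A \<open>C\<^sup>1\<close> approximation of the indicator of \<open>(s, t)\<close> whose derivative approximates
  \<open>\<delta>\<^sub>s - \<delta>\<^sub>t\<close>.\<close>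

definition plateau :: "real \<Rightarrow> real \<Rightarrow> nat \<Rightarrow> real \<Rightarrow> real" where
  "plateau s t n r = ramp (real n * (r - s) - 1) - ramp (real n * (r - t) + 3)"

lemma plateau_deriv:
  "(plateau s t n has_real_derivative real n * hat (real n * (r - s) - 1) - real n * hat (real n * (r - t) + 3)) (at r)"
proof -
  have "((\<lambda>r. ramp (real n * (r - c) + d)) has_real_derivative real n * hat (real n * (r - c) + d)) (at r)" for c d
    by (rule DERIV_chain2[OF ramp_deriv, THEN DERIV_cong]) (auto intro!: derivative_eq_intros)
  from DERIV_diff[OF this[where c = s and d = "-1"] this[where c = t and d = 3]] show ?thesis
    by (simp add: plateau_def [abs_def])
qed

lemma abs_plateau_le: "\<bar>plateau s t n r\<bar> \<le> 1"
  using ramp_bounds[of "real n * (r - s) - 1"] ramp_bounds[of "real n * (r - t) + 3"]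
  by (simp add: plateau_def)

text \<open>The offsets \<open>- 1\<close> and \<open>+ 3\<close> place the rise on
  [s + 1/n, s + 3/n] and the fall on [t - 3/n, t - 1/n]; the bound 6 = 3 + 3 keeps the two apart.
  The gaps of width 1/n put the closed support inside (s, t), so that a test function results even
  if s and t are the endpoints of the whole interval.\<close>

lemma plateau_support:
  assumes "real n * (t - s) \<ge> 6" "n > 0" "plateau s t n r \<noteq> 0"
  shows "r \<in> {s + 1 / real n .. t - 1 / real n}"
proof (rule ccontr)
  assume "\<not> ?thesis"
  then consider "r < s + 1 / real n" | "r > t - 1 / real n" by fastforce
  then have "plateau s t n r = 0"
  proof cases
    case 1
    then have "real n * (r - s) < 1" using assms by (simp add: field_simps)
    moreover have "real n * (r - t) + 3 \<le> 0" using calculation assms(1) by (simp add: algebra_simps)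
    ultimately show ?thesis by (simp add: plateau_def ramp_eq_0)
  next
    case 2
    then have "real n * (r - t) > - 1" using assms by (simp add: field_simps)
    moreover have "real n * (r - s) - 1 \<ge> 2" using calculation assms(1) by (simp add: algebra_simps)
    ultimately show ?thesis by (simp add: plateau_def ramp_eq_1)
  qed
  with assms show False by simp
qed

lemma C1_differentiable_on_UNIV_I:
  fixes f :: "real \<Rightarrow> real"
  assumes "\<And>t. (f has_real_derivative f' t) (at t)" "continuous_on UNIV f'"
  shows "f C1_differentiable_on UNIV"
  unfolding C1_differentiable_on_def
  using assms unfolding has_real_derivative_iff_has_vector_derivative by (intro exI[of _ f']) simp

lemma test_function_plateau:
  assumes "a \<le> s" "t \<le> b" "real n * (t - s) \<ge> 6" "n > 0"
  shows "test_function a b (plateau s t n)"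
  unfolding test_function_def
proof
  have "continuous_on UNIV (\<lambda>r. real n * hat (real n * (r - c) + d))" for c d
    by (intro continuous_intros continuous_on_compose2[OF continuous_on_hat[of UNIV]]) auto
  from continuous_on_diff[OF this[where c = s and d = "-1"] this[where c = t and d = 3]]
  have "continuous_on UNIV (\<lambda>r. real n * hat (real n * (r - s) - 1) - real n * hat (real n * (r - t) + 3))"
    by simp
  then show "plateau s t n C1_differentiable_on UNIV"
    by (rule C1_differentiable_on_UNIV_I[OF plateau_deriv])
  have "closure {r. plateau s t n r \<noteq> 0} \<subseteq> {s + 1 / real n .. t - 1 / real n}"
    using plateau_support[OF assms(3,4)] by (intro closure_minimal) auto
  also have "\<dots> \<subseteq> {a<..<b}"
  proof -
    have "1 / real n > 0" using assms by simp
    then show ?thesis using assms by (auto simp only: atLeastAtMost_iff greaterThanLessThan_iff subset_iff)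
  qed
  finally show "closure {r. plateau s t n r \<noteq> 0} \<subseteq> {a<..<b}" .
qed

section \<open>The fundamental theorem for weak derivatives and the vanishing lemma\<close>

text \<open>The definition is tested with \<open>plateau s t n\<close>. The derivative of the
  plateau is a difference of approximate identities at \<open>s\<close> and \<open>t\<close>, so one
  side tends to \<open>f s - f t\<close>; on the other side the plateau tends to the indicator of
  (s, t). Continuity of \<open>f\<close> on the closed interval is what admits the endpoints
  \<open>a\<close> and \<open>b\<close>.\<close>

lemma weak_deriv_FTC:
  fixes f g :: "real \<Rightarrow> 'a::euclidean_space"
  assumes f: "continuous_on {a..b} f" and g: "integrable (lebesgue_on {a<..<b}) g"
    and weak: "is_weak_deriv a b f g" and st: "a \<le> s" "s < t" "t \<le> b"
  shows "f t - f s = (\<integral>r. indicator {s<..<t} r *\<^sub>R g r \<partial>lebesgue_on {a<..<b})"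
proof -
  let ?M = "lebesgue_on {a<..<b}"
  define ks where "ks = (\<lambda>(n::nat) r. real n * hat (real n * (r - s) - 1))"
  define kt where "kt = (\<lambda>(n::nat) r. real n * hat (real n * (r - t) + 3))"
  have large: "\<forall>\<^sub>F n in sequentially. real n * (t - s) \<ge> 6 \<and> n > 0"
  proof -
    have "\<forall>\<^sub>F n in sequentially. real n \<ge> 6 / (t - s)"
      using filterlim_real_sequentially unfolding filterlim_at_top by blast
    then show ?thesis using eventually_gt_at_top[of 0]
      by eventually_elim (use st in \<open>auto simp: field_simps\<close>)
  qed
  have cont: "continuous_on A (ks n)" "continuous_on A (kt n)" for A n
    unfolding ks_def kt_def
    by (intro continuous_intros continuous_on_compose2[OF continuous_on_hat[of UNIV]], auto)+
  have D: "((\<lambda>r. ramp (real n * (r - c) + d)) has_vector_derivative real n * hat (real n * (r - c) + d))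
      (at r within A)" for n c d r A
  proof -
    have "((\<lambda>r. ramp (real n * (r - c) + d)) has_real_derivative real n * hat (real n * (r - c) + d)) (at r)"
      by (rule DERIV_chain2[OF ramp_deriv, THEN DERIV_cong]) (auto intro!: derivative_eq_intros)
    then show ?thesis
      by (metis has_real_derivative_iff_has_vector_derivative has_vector_derivative_at_within)
  qed
  have d: "(\<lambda>n. 3 / real n) \<longlonglongrightarrow> 0" by (rule lim_const_over_n)
  have ab: "a \<le> b" using st by simp
  have lim_s: "(\<lambda>n. \<integral>r. ks n r *\<^sub>R f r \<partial>?M) \<longlonglongrightarrow> f s"
  proof (rule tendsto_integral_approximate_identity[OF f _ d])
    show "\<forall>\<^sub>F n in sequentially. continuous_on {a..b} (ks n) \<and>
          (\<forall>r\<in>{a..b}. ks n r \<ge> 0 \<and> (ks n r \<noteq> 0 \<longrightarrow> \<bar>r - s\<bar> \<le> 3 / real n)) \<and> (\<integral>r. ks n r \<partial>?M) = 1"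
      using large
    proof eventually_elim
      case (elim n)
      have "\<bar>r - s\<bar> \<le> 3 / real n" if "ks n r \<noteq> 0" for r
      proof -
        have "hat (real n * (r - s) - 1) \<noteq> 0" using that by (simp add: ks_def)
        then have "\<not> (real n * (r - s) - 1 \<le> 0 \<or> real n * (r - s) - 1 \<ge> 2)" using hat_eq_0 by blast
        then have "\<bar>real n * (r - s)\<bar> \<le> 3" by linarith
        then show ?thesis using elim by (simp add: abs_mult pos_le_divide_eq mult.commute)
      qed
      \<comment> \<open>The mass is the increase of \<open>ramp\<close> over [a, b]. It equals 1
        because the step begins to the right of \<open>s \<ge> a\<close> and is completed before
        \<open>t \<le> b\<close>.\<close>
      moreover have "(\<integral>r. ks n r \<partial>?M) = ramp (real n * (b - s) + -1) - ramp (real n * (a - s) + -1)"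
        using integral_derivative_lebesgue_on_Ioo[OF ab D[of n s "-1"]] cont(1)[of "{a..b}" n]
        by (simp add: ks_def)
      moreover have "real n * (b - s) \<ge> real n * (t - s)" "real n * (a - s) \<le> 0"
        using st by (auto intro!: mult_left_mono simp: mult_le_0_iff)
      ultimately show ?case using elim cont hat_nonneg by (auto simp: ks_def ramp_eq_0 ramp_eq_1)
    qed
  qed (use st in auto)
  have lim_t: "(\<lambda>n. \<integral>r. kt n r *\<^sub>R f r \<partial>?M) \<longlonglongrightarrow> f t"
  proof (rule tendsto_integral_approximate_identity[OF f _ d])
    show "\<forall>\<^sub>F n in sequentially. continuous_on {a..b} (kt n) \<and>
          (\<forall>r\<in>{a..b}. kt n r \<ge> 0 \<and> (kt n r \<noteq> 0 \<longrightarrow> \<bar>r - t\<bar> \<le> 3 / real n)) \<and> (\<integral>r. kt n r \<partial>?M) = 1"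
      using large
    proof eventually_elim
      case (elim n)
      have "\<bar>r - t\<bar> \<le> 3 / real n" if "kt n r \<noteq> 0" for r
      proof -
        have "hat (real n * (r - t) + 3) \<noteq> 0" using that by (simp add: kt_def)
        then have "\<not> (real n * (r - t) + 3 \<le> 0 \<or> real n * (r - t) + 3 \<ge> 2)" using hat_eq_0 by blast
        then have "\<bar>real n * (r - t)\<bar> \<le> 3" by linarith
        then show ?thesis using elim by (simp add: abs_mult pos_le_divide_eq mult.commute)
      qed
      moreover have "(\<integral>r. kt n r \<partial>?M) = ramp (real n * (b - t) + 3) - ramp (real n * (a - t) + 3)"
        using integral_derivative_lebesgue_on_Ioo[OF ab D[of n t 3]] cont(2)[of "{a..b}" n]
        by (simp add: kt_def)
      moreover have "real n * (t - a) \<ge> real n * (t - s)" "real n * (b - t) \<ge> 0"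
        using st by (auto intro!: mult_left_mono)
      moreover have "real n * (a - t) = - (real n * (t - a))" by (simp add: algebra_simps)
      ultimately show ?case using elim cont hat_nonneg by (auto simp: kt_def ramp_eq_0 ramp_eq_1)
    qed
  qed (use st in auto)
  have "\<forall>\<^sub>F n in sequentially. (\<integral>r. ks n r *\<^sub>R f r \<partial>?M) - (\<integral>r. kt n r *\<^sub>R f r \<partial>?M) =
      - (\<integral>r. plateau s t n r *\<^sub>R g r \<partial>?M)"
    using large
  proof eventually_elim
    case (elim n)
    have "deriv (plateau s t n) = (\<lambda>r. ks n r - kt n r)"
      using DERIV_imp_deriv[OF plateau_deriv] by (simp add: ks_def kt_def fun_eq_iff)
    moreover have "integrable ?M (\<lambda>r. ks n r *\<^sub>R f r)" "integrable ?M (\<lambda>r. kt n r *\<^sub>R f r)"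
      by (intro integrable_lebesgue_on_Ioo continuous_intros cont f)+
    ultimately have "(\<integral>r. ks n r *\<^sub>R f r \<partial>?M) - (\<integral>r. kt n r *\<^sub>R f r \<partial>?M)
        = (\<integral>r. deriv (plateau s t n) r *\<^sub>R f r \<partial>?M)"
      by (simp add: scaleR_diff_left)
    also have "\<dots> = - (\<integral>r. plateau s t n r *\<^sub>R g r \<partial>?M)"
      using weak test_function_plateau[of a s t b n] elim st by (simp add: is_weak_deriv_def)
    finally show ?case .
  qed
  then have "(\<lambda>n. - (\<integral>r. plateau s t n r *\<^sub>R g r \<partial>?M)) \<longlonglongrightarrow> f s - f t"
    by (rule Lim_transform_eventually[OF tendsto_diff[OF lim_s lim_t]])
  then have lim1: "(\<lambda>n. \<integral>r. plateau s t n r *\<^sub>R g r \<partial>?M) \<longlonglongrightarrow> f t - f s"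
    using tendsto_minus by fastforce
  \<comment> \<open>Since \<open>g\<close> is only integrable, the limit is taken by dominated
    convergence, with \<open>norm (g r)\<close> as majorant because the plateau stays within
    [-1, 1].\<close>
  have "(\<lambda>n. \<integral>r. plateau s t n r *\<^sub>R g r \<partial>?M) \<longlonglongrightarrow> (\<integral>r. indicator {s<..<t} r *\<^sub>R g r \<partial>?M)"
  proof (rule integral_dominated_convergence[where w = "\<lambda>r. norm (g r)"])
    have plateau_cont: "continuous_on A (plateau s t n)" for A n
      by (rule DERIV_continuous_on) (rule DERIV_subset[OF plateau_deriv], simp)
    then have "plateau s t n \<in> borel_measurable ?M" for n
      by (intro continuous_imp_measurable_on_sets_lebesgue) auto
    then show "(\<lambda>r. plateau s t n r *\<^sub>R g r) \<in> borel_measurable ?M" for n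
      using g by measurable
    show "(\<lambda>r. indicator {s<..<t} r *\<^sub>R g r) \<in> borel_measurable ?M"
      using g by (intro borel_measurable_scaleR borel_measurable_indicator)
        (use st in \<open>auto simp: sets_restrict_space_iff\<close>)
    show "integrable ?M (\<lambda>r. norm (g r))" using g by (rule integrable_norm)
    show "AE r in ?M. norm (plateau s t n r *\<^sub>R g r) \<le> norm (g r)" for n
      by (intro always_eventually) (simp add: abs_plateau_le mult_left_le_one_le)
    show "AE r in ?M. (\<lambda>n. plateau s t n r *\<^sub>R g r) \<longlonglongrightarrow> indicator {s<..<t} r *\<^sub>R g r"
    proof (intro always_eventually allI)
      fix r
      have "\<forall>\<^sub>F n in sequentially. plateau s t n r = indicator {s<..<t} r"
      proof (cases "r \<in> {s<..<t}")
        case True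
        have "\<forall>\<^sub>F n in sequentially. real n \<ge> 3 / (r - s)" "\<forall>\<^sub>F n in sequentially. real n \<ge> 3 / (t - r)"
          using filterlim_real_sequentially unfolding filterlim_at_top by blast+
        then show ?thesis
        proof eventually_elim
          case (elim n)
          then have "real n * (r - s) \<ge> 3" "real n * (r - t) \<le> - 3"
            using True by (auto simp: field_simps)
          then show ?case using True by (simp add: plateau_def ramp_eq_0 ramp_eq_1)
        qed
      next
        case False
        show ?thesis using large
        proof eventually_elim
          case (elim n)
          have "r \<notin> {s + 1 / real n .. t - 1 / real n}"
          proof
            assume "r \<in> {s + 1 / real n .. t - 1 / real n}"
            moreover have "1 / real n > 0" using elim by simp
            ultimately have "r \<in> {s<..<t}" unfolding atLeastAtMost_iff greaterThanLessThan_iff by linarith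
            with False show False by simp
          qed
          then show ?case using False plateau_support elim by auto
        qed
      qed
      then show "(\<lambda>n. plateau s t n r *\<^sub>R g r) \<longlonglongrightarrow> indicator {s<..<t} r *\<^sub>R g r"
        by (intro tendsto_intros tendsto_eventually)
    qed
  qed
  with lim1 show ?thesis by (rule LIMSEQ_unique)
qed

text \<open>Vanishing of the integral spreads from intervals to Borel sets by a Dynkin argument,
  from there to Lebesgue sets by discarding null sets, and a density whose integral over every
  measurable set is zero vanishes almost everywhere.\<close>

lemma AE_zero_if_integral_Ioo_zero:
  fixes h :: "real \<Rightarrow> 'a::euclidean_space"
  assumes h: "integrable (lebesgue_on {a<..<b}) h"
    and zero: "\<And>s t. a \<le> s \<Longrightarrow> s < t \<Longrightarrow> t \<le> b \<Longrightarrow>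
      (\<integral>r. indicator {s<..<t} r *\<^sub>R h r \<partial>lebesgue_on {a<..<b}) = 0"
  shows "AE r in lebesgue_on {a<..<b}. h r = 0"
proof -
  let ?M = "lebesgue_on {a<..<b}"
  interpret finite_measure ?M by (rule finite_measure_lebesgue_on) simp
  have ind_int: "integrable ?M (\<lambda>r. indicator A r *\<^sub>R h r)" if "A \<in> sets lebesgue" for A
  proof -
    have "integrable ?M (\<lambda>r. indicator (A \<inter> {a<..<b}) r *\<^sub>R h r)"
      using that h by (intro integrable_mult_indicator) (auto simp: sets_restrict_space)
    then show ?thesis
      by (rule Bochner_Integration.integrable_cong[THEN iffD1, rotated -1]) (auto simp: indicator_def)
  qed
  \<comment> \<open>The generators of the Borel sets are all intervals, so arbitrary ones are
    clipped to [a, b]; an empty intersection gives 0 trivially.\<close>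
  have box_zero: "(\<integral>r. indicator {s<..<t} r *\<^sub>R h r \<partial>?M) = 0" for s t
  proof (cases "max a s < min b t")
    case True
    have "(\<integral>r. indicator {s<..<t} r *\<^sub>R h r \<partial>?M) = (\<integral>r. indicator {max a s<..<min b t} r *\<^sub>R h r \<partial>?M)"
      by (intro Bochner_Integration.integral_cong) (auto simp: indicator_def)
    then show ?thesis using zero[of "max a s" "min b t"] True by simp
  next
    case False
    have "(\<integral>r. indicator {s<..<t} r *\<^sub>R h r \<partial>?M) = (\<integral>r. 0 \<partial>?M)"
      by (intro Bochner_Integration.integral_cong) (use False in \<open>auto simp: indicator_def\<close>)
    then show ?thesis by simp
  qed
  \<comment> \<open>The case of complements below subtracts from the integral over the whole
    interval, which therefore has to vanish as well.\<close>
  have total_zero: "(\<integral>r. h r \<partial>?M) = 0"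
  proof -
    have "(\<integral>r. h r \<partial>?M) = (\<integral>r. indicator {a<..<b} r *\<^sub>R h r \<partial>?M)"
      by (intro Bochner_Integration.integral_cong) (auto simp: indicator_def)
    then show ?thesis using box_zero by simp
  qed
  have borel_zero: "(\<integral>r. indicator A r *\<^sub>R h r \<partial>?M) = 0" if "A \<in> sets borel" for A
  proof -
    have "Int_stable (range (\<lambda>(s, t). box s t :: real set))"
      by (force simp: Int_stable_def box_Int_box simp del: box_real)
    moreover have "range (\<lambda>(s, t). box s t :: real set) \<subseteq> Pow UNIV" by simp
    moreover have "A \<in> sigma_sets UNIV (range (\<lambda>(s, t). box s t :: real set))"
      using that unfolding borel_eq_box by (simp del: box_real)
    ultimately show ?thesis
    proof (induction rule: sigma_sets_induct_disjoint)
      case (basic A)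
      then show ?case using box_zero by (auto simp: box_real)
    next
      case (compl A)
      then have A: "A \<in> sets lebesgue" by (simp add: borel_eq_box del: box_real)
      have "(\<integral>r. indicator (UNIV - A) r *\<^sub>R h r \<partial>?M) = (\<integral>r. h r - indicator A r *\<^sub>R h r \<partial>?M)"
        by (intro Bochner_Integration.integral_cong) (auto simp: indicator_def)
      also have "\<dots> = 0" using ind_int[OF A] h compl.IH total_zero by simp
      finally show ?case .
    next
      case (union A)
      then have "A i \<in> sets borel" for i by (auto simp: borel_eq_box simp del: box_real)
      then have A: "A i \<in> sets lebesgue" for i by simp
      have restrict: "(\<integral>r. indicator B r *\<^sub>R h r \<partial>?M) = (LINT r:B \<inter> {a<..<b}|?M. h r)" for B
        unfolding set_lebesgue_integral_def
        by (intro Bochner_Integration.integral_cong) (auto simp: indicator_def)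
      have sets: "A i \<inter> {a<..<b} \<in> sets ?M" for i
        using A[of i] by (auto simp: sets_restrict_space)
      then have "(\<Union>i. A i \<inter> {a<..<b}) \<in> sets ?M" by (intro sets.countable_UN) auto
      then have "set_integrable ?M (\<Union>i. A i \<inter> {a<..<b}) h"
        using h unfolding set_integrable_def by (rule integrable_mult_indicator)
      then have "(LINT r:(\<Union>i. A i \<inter> {a<..<b})|?M. h r) = (\<Sum>i. LINT r:A i \<inter> {a<..<b}|?M. h r)"
        using union.hyps(1) sets
        by (intro lebesgue_integral_countable_add) (auto simp: disjoint_family_on_def)
      also have "\<dots> = 0" using union.IH by (simp add: restrict)
      moreover have "(\<Union>i. A i \<inter> {a<..<b}) = (\<Union>i. A i) \<inter> {a<..<b}" by blast
      ultimately show ?case unfolding restrict by simp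
    qed auto
  qed
  have "(\<integral>r. indicator A r *\<^sub>R h r \<partial>?M) = 0" if A: "A \<in> sets lebesgue" for A
  proof -
    \<comment> \<open>A Lebesgue set is a Borel set up to a subset of a Borel null set, which the
      integral does not see.\<close>
    from A obtain S N N' where SN: "A = S \<union> N" "N \<subseteq> N'" "N' \<in> null_sets lborel" "S \<in> sets lborel"
      by (rule sets_completionE)
    have "AE r in lebesgue. r \<notin> N'"
      using SN(3) by (intro AE_not_in) (metis null_sets_completionI)
    then have "AE r in ?M. r \<notin> N'" by (auto simp: AE_restrict_space_iff elim: eventually_mono)
    then have "AE r in ?M. indicator A r *\<^sub>R h r = indicator S r *\<^sub>R h r"
      by eventually_elim (use SN in \<open>auto simp: indicator_def\<close>)
    then have "(\<integral>r. indicator A r *\<^sub>R h r \<partial>?M) = (\<integral>r. indicator S r *\<^sub>R h r \<partial>?M)"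
      using ind_int[of A] ind_int[of S] A SN(4) by (intro integral_cong_AE) auto
    then show ?thesis using borel_zero SN(4) by simp
  qed
  then show ?thesis
    using h by (intro density_zero) (auto simp: sets_restrict_space_iff set_lebesgue_integral_def)
qed

lemma C1_differentiable_on_UNIV_D:
  fixes f :: "real \<Rightarrow> real"
  assumes "f C1_differentiable_on UNIV"
  shows "(f has_real_derivative deriv f t) (at t)" "continuous_on A (deriv f)"
proof -
  obtain D where D: "\<And>t. (f has_real_derivative D t) (at t)" "continuous_on UNIV D"
    using assms by (auto simp: C1_differentiable_on_def has_real_derivative_iff_has_vector_derivative)
  then have "deriv f = D" by (auto simp: fun_eq_iff intro: DERIV_imp_deriv)
  with D show "(f has_real_derivative deriv f t) (at t)" "continuous_on A (deriv f)"
    by (auto intro: continuous_on_subset)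
qed

lemma continuous_on_Icc_bounded:
  fixes f :: "real \<Rightarrow> 'a::real_normed_vector"
  assumes "continuous_on {a..b} f"
  shows "\<exists>K. \<forall>t\<in>{a..b}. norm (f t) \<le> K"
  using compact_imp_bounded[OF compact_continuous_image[OF assms compact_Icc]]
  by (auto simp: bounded_iff)

lemma integral_indicator_Ioo:
  fixes f :: "real \<Rightarrow> 'a::euclidean_space"
  assumes "a \<le> s" "t \<le> b"
  shows "(\<integral>r. indicator {s<..<t} r *\<^sub>R f r \<partial>lebesgue_on {a<..<b}) = (\<integral>r. f r \<partial>lebesgue_on {s<..<t})"
proof -
  have "indicator {a<..<b} r *\<^sub>R (indicator {s<..<t} r *\<^sub>R f r) = indicator {s<..<t} r *\<^sub>R f r" for r
    using assms by (simp add: indicator_def)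
  then show ?thesis by (simp add: integral_restrict_space del: scaleR_scaleR)
qed

section \<open>Indefinite integrals have their integrand as weak derivative\<close>

text \<open>Fubini on the triangle r < t replaces integration by parts, for which \<open>h\<close>
  is not regular enough. The formula for \<open>v\<close> is required only in the open interval,
  since its values at the endpoints do not affect the integrals.\<close>

lemma weak_deriv_indefinite_integral:
  fixes h v :: "real \<Rightarrow> 'a::euclidean_space"
  assumes ab: "a \<le> b" and h: "integrable (lebesgue_on {a<..<b}) h"
    and v: "\<And>t. t \<in> {a<..<b} \<Longrightarrow> v t = v0 + (\<integral>r. indicator {a<..<t} r *\<^sub>R h r \<partial>lebesgue_on {a<..<b})"
  shows "is_weak_deriv a b v h"
  unfolding is_weak_deriv_def
proof (intro allI impI)
  fix \<phi> :: "real \<Rightarrow> real"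
  let ?M = "lebesgue_on {a<..<b}"
  assume "test_function a b \<phi>"
  then have C1: "\<phi> C1_differentiable_on UNIV" and supp: "closure {t. \<phi> t \<noteq> 0} \<subseteq> {a<..<b}"
    by (auto simp: test_function_def)
  have \<phi>_ends: "\<phi> a = 0" "\<phi> b = 0"
    using supp closure_subset[of "{t. \<phi> t \<noteq> 0}"] by auto
  note D = C1_differentiable_on_UNIV_D(1)[OF C1, unfolded has_real_derivative_iff_has_vector_derivative]
    and cont = C1_differentiable_on_UNIV_D(2)[OF C1]
  interpret finite_measure ?M by (rule finite_measure_lebesgue_on) simp
  interpret P: pair_sigma_finite ?M ?M ..
  \<comment> \<open>The integrand on the triangle r < t. Integrating over r returns
    \<open>deriv \<phi> t *\<^sub>R (v t - v0)\<close>; integrating over t gives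
    \<open>\<phi> b - \<phi> r = - \<phi> r\<close> times \<open>h r\<close>.\<close>
  define F where "F = (\<lambda>r t. (deriv \<phi> t * indicator {r<..} t) *\<^sub>R h r)"
  obtain K where K: "\<And>t. t \<in> {a..b} \<Longrightarrow> \<bar>deriv \<phi> t\<bar> \<le> K"
    using continuous_on_Icc_bounded[OF cont] unfolding real_norm_def by blast
  have meas_h [measurable]: "h \<in> borel_measurable ?M" using h by simp
  have meas_phi [measurable]: "deriv \<phi> \<in> borel_measurable ?M"
    using integrable_lebesgue_on_Ioo[OF cont] by simp
  have meas_id [measurable]: "(\<lambda>x. x) \<in> borel_measurable ?M"
    using id_borel_measurable_lebesgue_on by (simp add: id_def)
  have "(\<lambda>p. F (fst p) (snd p)) = (\<lambda>p. if fst p < snd p then deriv \<phi> (snd p) *\<^sub>R h (fst p) else 0)"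
    by (auto simp: F_def fun_eq_iff)
  also have "\<dots> \<in> borel_measurable (?M \<Otimes>\<^sub>M ?M)"
    by measurable
  finally have meas_F: "(\<lambda>p. F (fst p) (snd p)) \<in> borel_measurable (?M \<Otimes>\<^sub>M ?M)" .
  have meas_Fr: "F r \<in> borel_measurable ?M" for r
  proof -
    have "F r = (\<lambda>t. if r < t then deriv \<phi> t *\<^sub>R h r else 0)" by (auto simp: F_def fun_eq_iff)
    then show ?thesis by simp
  qed
  have F_bound: "norm (F r t) \<le> K * norm (h r)" if "t \<in> {a<..<b}" for r t
  proof -
    have "\<bar>deriv \<phi> t * indicator {r<..} t\<bar> \<le> K"
      using that K[of t] by (auto simp: indicator_def)
    then show ?thesis unfolding F_def by (simp add: mult_right_mono)
  qed
  have int_Fr: "integrable ?M (F r)" for r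
  proof (rule Bochner_Integration.integrable_bound[OF integrable_const[of "K * norm (h r)"] meas_Fr])
    show "AE t in ?M. norm (F r t) \<le> norm (K * norm (h r))"
    proof (rule AE_I2)
      fix t assume "t \<in> space ?M"
      then have "norm (F r t) \<le> K * norm (h r)" by (intro F_bound) simp
      then show "norm (F r t) \<le> norm (K * norm (h r))" by simp
    qed
  qed
  have int_F: "integrable (?M \<Otimes>\<^sub>M ?M) (\<lambda>(r, t). F r t)"
  proof (rule P.Fubini_integrable)
    show "(\<lambda>(r, t). F r t) \<in> borel_measurable (?M \<Otimes>\<^sub>M ?M)"
      using meas_F by (simp add: case_prod_beta)
    show "AE r in ?M. integrable ?M (\<lambda>t. (case (r, t) of (r, t) \<Rightarrow> F r t))"
      using int_Fr by simp
    show "integrable ?M (\<lambda>r. \<integral>t. norm (case (r, t) of (r, t) \<Rightarrow> F r t) \<partial>?M)"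
    proof (rule Bochner_Integration.integrable_bound[where f="\<lambda>r. (K * measure ?M (space ?M)) * norm (h r)"])
      have le: "(\<integral>t. norm (F r t) \<partial>?M) \<le> (K * measure ?M (space ?M)) * norm (h r)" for r
      proof -
        have "(\<integral>t. norm (F r t) \<partial>?M) \<le> (\<integral>t. K * norm (h r) \<partial>?M)"
          by (rule integral_mono[OF integrable_norm[OF int_Fr] integrable_const]) (simp add: F_bound)
        then show ?thesis by (simp add: ac_simps)
      qed
      show "AE r in ?M. norm (\<integral>t. norm (case (r, t) of (r, t) \<Rightarrow> F r t) \<partial>?M)
          \<le> norm ((K * measure ?M (space ?M)) * norm (h r))"
      proof (rule AE_I2)
        fix r
        have "0 \<le> (\<integral>t. norm (F r t) \<partial>?M)" by simp
        with le[of r] show "norm (\<integral>t. norm (case (r, t) of (r, t) \<Rightarrow> F r t) \<partial>?M)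
          \<le> norm ((K * measure ?M (space ?M)) * norm (h r))"
          unfolding prod.case real_norm_def by linarith
      qed
      show "(\<lambda>r. \<integral>t. norm (case (r, t) of (r, t) \<Rightarrow> F r t) \<partial>?M) \<in> borel_measurable ?M"
        using meas_F by (intro borel_measurable_lebesgue_integral) (simp add: case_prod_beta)
    qed (use h in auto)
  qed
  have inner_t: "(\<integral>r. F r t \<partial>?M) = deriv \<phi> t *\<^sub>R (v t - v0)" if t: "t \<in> {a<..<b}" for t
  proof -
    have "(\<integral>r. F r t \<partial>?M) = (\<integral>r. deriv \<phi> t *\<^sub>R (indicator {a<..<t} r *\<^sub>R h r) \<partial>?M)"
      by (intro Bochner_Integration.integral_cong) (auto simp: F_def indicator_def)
    also have "\<dots> = deriv \<phi> t *\<^sub>R (\<integral>r. indicator {a<..<t} r *\<^sub>R h r \<partial>?M)"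
      by (rule integral_scaleR_right)
    finally show ?thesis using v[OF t] by simp
  qed
  have inner_r: "(\<integral>t. F r t \<partial>?M) = - (\<phi> r *\<^sub>R h r)" if r: "r \<in> {a<..<b}" for r
  proof -
    have "(\<integral>t. F r t \<partial>?M) = (\<integral>t. deriv \<phi> t * indicator {r<..} t \<partial>?M) *\<^sub>R h r"
      unfolding F_def
    proof (rule integral_scaleR_left)
      have "(\<lambda>t. if r < t then deriv \<phi> t else 0) \<in> borel_measurable ?M" by measurable
      also have "(\<lambda>t. if r < t then deriv \<phi> t else 0) = (\<lambda>t. deriv \<phi> t * indicator {r<..} t)"
        by (auto simp: fun_eq_iff)
      finally show "integrable ?M (\<lambda>t. deriv \<phi> t * indicator {r<..} t)"
        by (rule Bochner_Integration.integrable_bound[OF integrable_lebesgue_on_Ioo[OF cont]])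
           (simp add: indicator_def)
    qed
    also have "(\<integral>t. deriv \<phi> t * indicator {r<..} t \<partial>?M)
        = (\<integral>t. indicator {r<..<b} t *\<^sub>R deriv \<phi> t \<partial>?M)"
      by (rule Bochner_Integration.integral_cong) (simp_all add: indicator_def)
    also have "\<dots> = (\<integral>t. deriv \<phi> t \<partial>lebesgue_on {r<..<b})"
      using r by (intro integral_indicator_Ioo) auto
    also have "\<dots> = \<phi> b - \<phi> r"
      using r by (intro integral_derivative_lebesgue_on_Ioo[OF _ has_vector_derivative_at_within[OF D] cont]) simp
    finally show ?thesis by (simp add: \<phi>_ends)
  qed
  \<comment> \<open>Nothing is assumed about the measurability of \<open>v\<close>; integrability of
    this product comes from Fubini, as the product is an inner integral of \<open>F\<close>.\<close>
  have int_v: "integrable ?M (\<lambda>t. deriv \<phi> t *\<^sub>R (v t - v0))"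
  proof -
    have "integrable ?M (\<lambda>t. \<integral>r. F r t \<partial>?M)"
      using P.integrable_snd[OF int_F] by simp
    then show ?thesis
      by (rule Bochner_Integration.integrable_cong[THEN iffD1, rotated -1]) (auto simp: inner_t)
  qed
  \<comment> \<open>The constant \<open>v0\<close> is split off. It contributes nothing, because the
    derivative of a test function integrates to 0.\<close>
  have "(\<integral>t. deriv \<phi> t *\<^sub>R v t \<partial>?M) = (\<integral>t. deriv \<phi> t *\<^sub>R (v t - v0) + deriv \<phi> t *\<^sub>R v0 \<partial>?M)"
    by (simp add: scaleR_diff_right)
  also have "\<dots> = (\<integral>t. deriv \<phi> t *\<^sub>R (v t - v0) \<partial>?M) + (\<integral>t. deriv \<phi> t *\<^sub>R v0 \<partial>?M)"
    using int_v by (rule Bochner_Integration.integral_add)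
      (intro integrable_lebesgue_on_Ioo continuous_intros cont)
  also have "(\<integral>t. deriv \<phi> t *\<^sub>R v0 \<partial>?M) = (\<integral>t. deriv \<phi> t \<partial>?M) *\<^sub>R v0"
    using integrable_lebesgue_on_Ioo[OF cont] by simp
  also have "(\<integral>t. deriv \<phi> t \<partial>?M) = 0"
    using integral_derivative_lebesgue_on_Ioo[OF ab has_vector_derivative_at_within[OF D] cont] \<phi>_ends
    by simp
  also have "(\<integral>t. deriv \<phi> t *\<^sub>R (v t - v0) \<partial>?M) = (\<integral>t. (\<integral>r. F r t \<partial>?M) \<partial>?M)"
    by (intro Bochner_Integration.integral_cong) (auto simp: inner_t)
  also have "\<dots> = (\<integral>r. (\<integral>t. F r t \<partial>?M) \<partial>?M)"
    by (rule P.Fubini_integral[OF int_F])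
  also have "\<dots> = (\<integral>r. - (\<phi> r *\<^sub>R h r) \<partial>?M)"
    by (intro Bochner_Integration.integral_cong) (auto simp: inner_r)
  finally show "(\<integral>t. deriv \<phi> t *\<^sub>R v t \<partial>?M) = - (\<integral>t. \<phi> t *\<^sub>R h t \<partial>?M)" by simp
qed

section \<open>Uniqueness of weak derivatives and evaluation of the H1 norm\<close>

text \<open>By the fundamental theorem both candidates have the integral \<open>f t - f s\<close>
  over every subinterval, so the vanishing lemma applies to their difference.\<close>

lemma weak_deriv_unique:
  fixes f g g' :: "real \<Rightarrow> 'a::euclidean_space"
  assumes "continuous_on {a..b} f"
    and g: "integrable (lebesgue_on {a<..<b}) g" "is_weak_deriv a b f g"
    and g': "integrable (lebesgue_on {a<..<b}) g'" "is_weak_deriv a b f g'"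
  shows "AE t in lebesgue_on {a<..<b}. g t = g' t"
proof -
  have "AE t in lebesgue_on {a<..<b}. g t - g' t = 0"
  proof (rule AE_zero_if_integral_Ioo_zero)
    fix s t assume st: "a \<le> s" "s < t" "t \<le> b"
    have int: "integrable (lebesgue_on {a<..<b}) (\<lambda>r. indicator {s<..<t} r *\<^sub>R k r)"
      if "integrable (lebesgue_on {a<..<b}) k" for k :: "real \<Rightarrow> 'a"
      using that st by (intro integrable_mult_indicator) (auto simp: sets_restrict_space_iff)
    show "(\<integral>r. indicator {s<..<t} r *\<^sub>R (g r - g' r) \<partial>lebesgue_on {a<..<b}) = 0"
      using weak_deriv_FTC[OF assms(1) g st] weak_deriv_FTC[OF assms(1) g' st] int[OF g(1)] int[OF g'(1)]
      by (simp add: scaleR_diff_right)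
  qed (use g g' in simp)
  then show ?thesis by simp
qed

lemma integrable_if_square_integrable:
  fixes f :: "real \<Rightarrow> 'a::euclidean_space"
  assumes "square_integrable a b f"
  shows "integrable (lebesgue_on {a<..<b}) f"
proof (rule Bochner_Integration.integrable_bound[where f="\<lambda>t. 1 + (norm (f t))\<^sup>2"])
  interpret finite_measure "lebesgue_on {a<..<b}" by (rule finite_measure_lebesgue_on) simp
  show "integrable (lebesgue_on {a<..<b}) (\<lambda>t. 1 + (norm (f t))\<^sup>2)"
    using assms by (auto simp: square_integrable_def)
  have "x \<le> 1 + x\<^sup>2" for x :: real
  proof -
    have "2 * x \<le> 1 + x\<^sup>2" using zero_le_power2[of "x - 1"] by (simp add: power2_diff)
    moreover have "0 \<le> x\<^sup>2" by simp
    ultimately show ?thesis by linarith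
  qed
  then show "AE t in lebesgue_on {a<..<b}. norm (f t) \<le> norm (1 + (norm (f t))\<^sup>2)"
    by simp
qed (use assms in \<open>simp add: square_integrable_def\<close>)

text \<open>The norm refers to a weak derivative picked by \<open>SOME\<close>. Uniqueness allows
  any explicitly known one in its place, which is how the cost of the competitor becomes
  computable.\<close>

lemma H1_norm_eq:
  fixes f g :: "real \<Rightarrow> 'a::euclidean_space"
  assumes "continuous_on {a..b} f" and g: "square_integrable a b g" "is_weak_deriv a b f g"
  shows "(H1_norm a b f)\<^sup>2 = (\<integral>t. (norm (f t))\<^sup>2 \<partial>lebesgue_on {a<..<b}) +
    (\<integral>t. (norm (g t))\<^sup>2 \<partial>lebesgue_on {a<..<b})"
proof -
  let ?w = "weak_deriv a b f"
  have w: "square_integrable a b ?w \<and> is_weak_deriv a b f ?w"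
    unfolding weak_deriv_def by (rule someI[of _ g]) (use g in blast)
  have "AE t in lebesgue_on {a<..<b}. ?w t = g t"
    using w g by (intro weak_deriv_unique[OF assms(1)] integrable_if_square_integrable) auto
  then have "(\<integral>t. (norm (?w t))\<^sup>2 \<partial>lebesgue_on {a<..<b}) = (\<integral>t. (norm (g t))\<^sup>2 \<partial>lebesgue_on {a<..<b})"
    using w g by (intro integral_cong_AE) (auto simp: square_integrable_def)
  then show ?thesis by (simp add: H1_norm_def)
qed

lemma square_integrable_continuous:
  fixes f :: "real \<Rightarrow> 'a::euclidean_space"
  assumes "continuous_on {a..b} f"
  shows "square_integrable a b f"
proof -
  have "continuous_on {a..b} (\<lambda>t. (norm (f t))\<^sup>2)" using assms by (intro continuous_intros)
  then show ?thesis
    using assms by (simp add: square_integrable_def integrable_lebesgue_on_Ioo borel_measurable_integrable)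
qed

lemma power2_norm_add_le:
  fixes x y :: "'a::real_inner"
  shows "(norm (x + y))\<^sup>2 \<le> 2 * (norm x)\<^sup>2 + 2 * (norm y)\<^sup>2"
proof -
  have "(norm (x + y))\<^sup>2 \<le> (norm x + norm y)\<^sup>2"
    by (intro power_mono norm_triangle_ineq) auto
  also have "\<dots> \<le> 2 * (norm x)\<^sup>2 + 2 * (norm y)\<^sup>2"
    using zero_le_power2[of "norm x - norm y"] by (simp add: power2_diff power2_sum)
  finally show ?thesis .
qed
lemma square_integrable_add:
  fixes f g :: "real \<Rightarrow> 'a::euclidean_space"
  assumes "square_integrable a b f" "square_integrable a b g"
  shows "square_integrable a b (\<lambda>t. f t + g t)"
  unfolding square_integrable_def
proof
  show meas: "(\<lambda>t. f t + g t) \<in> borel_measurable (lebesgue_on {a<..<b})"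
    using assms by (auto simp: square_integrable_def)
  show "integrable (lebesgue_on {a<..<b}) (\<lambda>t. (norm (f t + g t))\<^sup>2)"
  proof (rule Bochner_Integration.integrable_bound)
    show "integrable (lebesgue_on {a<..<b}) (\<lambda>t. 2 * (norm (f t))\<^sup>2 + 2 * (norm (g t))\<^sup>2)"
      using assms by (auto simp: square_integrable_def)
    show "AE t in lebesgue_on {a<..<b}. norm ((norm (f t + g t))\<^sup>2)
        \<le> norm (2 * (norm (f t))\<^sup>2 + 2 * (norm (g t))\<^sup>2)"
      using power2_norm_add_le[of "f _" "g _"] by (intro AE_I2) simp
  qed (use meas in measurable)
qed

lemma H1I:
  fixes f g :: "real \<Rightarrow> 'a::euclidean_space"
  assumes "continuous_on {a..b} f" "square_integrable a b g" "is_weak_deriv a b f g"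
  shows "f \<in> H1 a b"
  using assms square_integrable_continuous[OF assms(1)] by (auto simp: H1_def)

lemma integrable_lebesgue_on_Ioo_mono:
  fixes f :: "real \<Rightarrow> 'a::euclidean_space"
  assumes "integrable (lebesgue_on {a<..<b}) f" "c \<le> b"
  shows "integrable (lebesgue_on {a<..<c}) f"
proof -
  have "set_integrable lebesgue {a<..<b} f"
    using assms(1) by (simp add: integrable_restrict_space set_integrable_def)
  then have "set_integrable lebesgue {a<..<c} f"
    by (rule set_integrable_subset) (use assms(2) in auto)
  then show ?thesis by (rule absolutely_integrable_imp_integrable) auto
qed

section \<open>Calculus rules for weak derivatives\<close>

lemma weak_deriv_C1:
  fixes f :: "real \<Rightarrow> 'a::euclidean_space"
  assumes ab: "a \<le> b" and D: "\<And>t. t \<in> {a..b} \<Longrightarrow> (f has_vector_derivative f' t) (at t within {a..b})"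
    and cont: "continuous_on {a..b} f'"
  shows "is_weak_deriv a b f f'"
proof (rule weak_deriv_indefinite_integral[OF ab integrable_lebesgue_on_Ioo[OF cont]])
  fix t assume t: "t \<in> {a<..<b}"
  have "(\<integral>r. f' r \<partial>lebesgue_on {a<..<t}) = f t - f a"
    using t by (intro integral_derivative_lebesgue_on_Ioo[where f=f and f'=f'])
      (auto intro!: has_vector_derivative_within_subset[OF D] continuous_on_subset[OF cont])
  then show "f t = f a + (\<integral>r. indicator {a<..<t} r *\<^sub>R f' r \<partial>lebesgue_on {a<..<b})"
    using t by (subst integral_indicator_Ioo) auto
qed

lemma continuous_on_if_DERIV:
  fixes f :: "real \<Rightarrow> real"
  assumes "\<And>t. (f has_real_derivative f' t) (at t)"
  shows "continuous_on A f"
  by (rule DERIV_continuous_on[where D=f']) (rule has_field_derivative_at_within[OF assms])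

lemma test_function_continuous:
  assumes "test_function a b \<phi>"
  shows "continuous_on A \<phi>" "continuous_on A (deriv \<phi>)"
  using assms C1_differentiable_on_UNIV_D[of \<phi>] continuous_on_if_DERIV[of \<phi> "deriv \<phi>"]
  by (auto simp: test_function_def)

lemma integrable_continuous_scaleR:
  fixes g :: "real \<Rightarrow> 'a::euclidean_space"
  assumes \<phi>: "continuous_on {a..b} \<phi>" and g: "integrable (lebesgue_on {a<..<b}) g"
  shows "integrable (lebesgue_on {a<..<b}) (\<lambda>t. \<phi> t *\<^sub>R g t)"
proof -
  obtain K where K: "\<And>t. t \<in> {a..b} \<Longrightarrow> \<bar>\<phi> t\<bar> \<le> K"
    using continuous_on_Icc_bounded[OF \<phi>] unfolding real_norm_def by blast
  show ?thesis
  proof (rule Bochner_Integration.integrable_bound[where f="\<lambda>t. K * norm (g t)"])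
    show "AE t in lebesgue_on {a<..<b}. norm (\<phi> t *\<^sub>R g t) \<le> norm (K * norm (g t))"
      using K by (intro AE_I2) (auto simp: abs_mult intro!: mult_right_mono order_trans[OF K])
    show "(\<lambda>t. \<phi> t *\<^sub>R g t) \<in> borel_measurable (lebesgue_on {a<..<b})"
      using g integrable_lebesgue_on_Ioo[OF \<phi>] by measurable
  qed (use g in auto)
qed

lemma weak_deriv_add:
  fixes f f2 :: "real \<Rightarrow> 'a::euclidean_space"
  assumes "continuous_on {a..b} f" "integrable (lebesgue_on {a<..<b}) g" "is_weak_deriv a b f g"
    and "continuous_on {a..b} f2" "integrable (lebesgue_on {a<..<b}) g2" "is_weak_deriv a b f2 g2"
  shows "is_weak_deriv a b (\<lambda>t. f t + f2 t) (\<lambda>t. g t + g2 t)"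
  unfolding is_weak_deriv_def
proof (intro allI impI)
  fix \<phi> assume \<phi>: "test_function a b \<phi>"
  note cont = test_function_continuous[OF \<phi>]
  have "integrable (lebesgue_on {a<..<b}) (\<lambda>t. deriv \<phi> t *\<^sub>R f t)"
    "integrable (lebesgue_on {a<..<b}) (\<lambda>t. deriv \<phi> t *\<^sub>R f2 t)"
    "integrable (lebesgue_on {a<..<b}) (\<lambda>t. \<phi> t *\<^sub>R g t)"
    "integrable (lebesgue_on {a<..<b}) (\<lambda>t. \<phi> t *\<^sub>R g2 t)"
    by (intro integrable_continuous_scaleR cont assms integrable_lebesgue_on_Ioo[OF assms(1)]
        integrable_lebesgue_on_Ioo[OF assms(4)])+
  then show "(\<integral>t. deriv \<phi> t *\<^sub>R (f t + f2 t) \<partial>lebesgue_on {a<..<b}) =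
      - (\<integral>t. \<phi> t *\<^sub>R (g t + g2 t) \<partial>lebesgue_on {a<..<b})"
    using assms(3,6) \<phi> by (simp add: scaleR_add_right is_weak_deriv_def)
qed

text \<open>The product \<open>\<phi> * \<eta>\<close> is again a test function, its support being
  contained in that of \<open>\<phi>\<close>. Testing \<open>f\<close> with it and expanding the
  classical derivative gives the product rule.\<close>

lemma weak_deriv_scaleR:
  fixes f g :: "real \<Rightarrow> 'a::euclidean_space"
  assumes f: "continuous_on {a..b} f" and g: "integrable (lebesgue_on {a<..<b}) g"
    and weak: "is_weak_deriv a b f g"
    and \<eta>: "\<And>t. (\<eta> has_real_derivative \<eta>' t) (at t)" "continuous_on UNIV \<eta>'"
  shows "is_weak_deriv a b (\<lambda>t. \<eta> t *\<^sub>R f t) (\<lambda>t. \<eta>' t *\<^sub>R f t + \<eta> t *\<^sub>R g t)"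
  unfolding is_weak_deriv_def
proof (intro allI impI)
  fix \<phi> assume \<phi>: "test_function a b \<phi>"
  let ?M = "lebesgue_on {a<..<b}"
  note cont = test_function_continuous[OF \<phi>]
  have \<eta>_cont: "continuous_on A \<eta>" "continuous_on A \<eta>'" for A
    using continuous_on_if_DERIV[OF \<eta>(1)] continuous_on_subset[OF \<eta>(2)] by auto
  have D: "((\<lambda>t. \<phi> t * \<eta> t) has_real_derivative deriv \<phi> t * \<eta> t + \<phi> t * \<eta>' t) (at t)" for t
    using \<phi> \<eta>(1) C1_differentiable_on_UNIV_D(1)[of \<phi> t]
    by (auto simp: test_function_def intro!: derivative_eq_intros)
  have "test_function a b (\<lambda>t. \<phi> t * \<eta> t)"
    unfolding test_function_def
  proof
    have "continuous_on UNIV (\<lambda>t. deriv \<phi> t * \<eta> t + \<phi> t * \<eta>' t)"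
      by (intro continuous_intros cont \<eta>_cont)
    then show "(\<lambda>t. \<phi> t * \<eta> t) C1_differentiable_on UNIV"
      by (rule C1_differentiable_on_UNIV_I[OF D])
    have "closure {t. \<phi> t * \<eta> t \<noteq> 0} \<subseteq> closure {t. \<phi> t \<noteq> 0}" by (rule closure_mono) auto
    then show "closure {t. \<phi> t * \<eta> t \<noteq> 0} \<subseteq> {a<..<b}"
      using \<phi> by (auto simp: test_function_def)
  qed
  then have "(\<integral>t. (deriv \<phi> t * \<eta> t + \<phi> t * \<eta>' t) *\<^sub>R f t \<partial>?M) = - (\<integral>t. (\<phi> t * \<eta> t) *\<^sub>R g t \<partial>?M)"
    using weak[unfolded is_weak_deriv_def, rule_format, of "\<lambda>t. \<phi> t * \<eta> t"]
    unfolding DERIV_imp_deriv[OF D] by simp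
  moreover have int: "integrable ?M (\<lambda>t. (deriv \<phi> t * \<eta> t) *\<^sub>R f t)"
    "integrable ?M (\<lambda>t. (\<phi> t * \<eta>' t) *\<^sub>R f t)" "integrable ?M (\<lambda>t. (\<phi> t * \<eta> t) *\<^sub>R g t)"
    by (rule integrable_continuous_scaleR; intro continuous_intros cont \<eta>_cont g integrable_lebesgue_on_Ioo[OF f])+
  ultimately have "(\<integral>t. (deriv \<phi> t * \<eta> t) *\<^sub>R f t \<partial>?M) + (\<integral>t. (\<phi> t * \<eta>' t) *\<^sub>R f t \<partial>?M)
      = - (\<integral>t. (\<phi> t * \<eta> t) *\<^sub>R g t \<partial>?M)"
    by (simp add: scaleR_add_left)
  moreover have "(\<integral>t. \<phi> t *\<^sub>R (\<eta>' t *\<^sub>R f t + \<eta> t *\<^sub>R g t) \<partial>?M)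
      = (\<integral>t. (\<phi> t * \<eta>' t) *\<^sub>R f t \<partial>?M) + (\<integral>t. (\<phi> t * \<eta> t) *\<^sub>R g t \<partial>?M)"
    using int by (simp add: scaleR_add_right)
  ultimately show "(\<integral>t. deriv \<phi> t *\<^sub>R \<eta> t *\<^sub>R f t \<partial>?M) =
      - (\<integral>t. \<phi> t *\<^sub>R (\<eta>' t *\<^sub>R f t + \<eta> t *\<^sub>R g t) \<partial>?M)"
    unfolding scaleR_scaleR by (simp add: eq_diff_eq[symmetric])
qed

lemma change_of_variables_lebesgue_on:
  fixes g :: "real \<Rightarrow> 'a::euclidean_space"
  assumes "\<And>t. t \<in> {c<..<d} \<Longrightarrow> (\<theta> has_real_derivative \<theta>' t) (at t)"
    and "\<And>t. t \<in> {c<..<d} \<Longrightarrow> \<theta>' t \<ge> 0"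
    and "inj_on \<theta> {c<..<d}" "\<theta> ` {c<..<d} = {a<..<b}"
    and g: "integrable (lebesgue_on {a<..<b}) g"
  shows "integrable (lebesgue_on {c<..<d}) (\<lambda>t. \<theta>' t *\<^sub>R g (\<theta> t))"
    and "(\<integral>t. \<theta>' t *\<^sub>R g (\<theta> t) \<partial>lebesgue_on {c<..<d}) = (\<integral>t. g t \<partial>lebesgue_on {a<..<b})"
proof -
  have "g absolutely_integrable_on {a<..<b}"
    using g by (simp add: integrable_restrict_space set_integrable_def)
  then have *: "(\<lambda>t. \<bar>\<theta>' t\<bar> *\<^sub>R g (\<theta> t)) absolutely_integrable_on {c<..<d} \<and>
      integral {c<..<d} (\<lambda>t. \<bar>\<theta>' t\<bar> *\<^sub>R g (\<theta> t)) = integral {a<..<b} g"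
    using assms(4)
    by (subst has_absolute_integral_change_of_variables_real[where h=\<theta>'])
       (use assms in \<open>auto intro: DERIV_subset\<close>)
  then have "integrable (lebesgue_on {c<..<d}) (\<lambda>t. \<bar>\<theta>' t\<bar> *\<^sub>R g (\<theta> t))"
    by (intro absolutely_integrable_imp_integrable) auto
  then show int: "integrable (lebesgue_on {c<..<d}) (\<lambda>t. \<theta>' t *\<^sub>R g (\<theta> t))"
    by (rule Bochner_Integration.integrable_cong[THEN iffD1, rotated -1]) (auto simp: assms(2))
  have "(\<integral>t. \<theta>' t *\<^sub>R g (\<theta> t) \<partial>lebesgue_on {c<..<d}) = integral {c<..<d} (\<lambda>t. \<theta>' t *\<^sub>R g (\<theta> t))"
    by (rule lebesgue_integral_eq_integral[OF int]) simp
  also have "\<dots> = integral {c<..<d} (\<lambda>t. \<bar>\<theta>' t\<bar> *\<^sub>R g (\<theta> t))"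
    by (rule Henstock_Kurzweil_Integration.integral_cong) (simp add: assms(2))
  finally show "(\<integral>t. \<theta>' t *\<^sub>R g (\<theta> t) \<partial>lebesgue_on {c<..<d}) = (\<integral>t. g t \<partial>lebesgue_on {a<..<b})"
    using * lebesgue_integral_eq_integral[OF g] by simp
qed

lemma has_vector_derivative_zero_dominated:
  fixes f :: "real \<Rightarrow> 'a::real_normed_vector" and \<theta> :: "real \<Rightarrow> real"
  assumes \<theta>: "(\<theta> has_real_derivative 0) (at s)"
    and bound: "\<forall>\<^sub>F t in at s. norm (f t - f s) \<le> L * \<bar>\<theta> t - \<theta> s\<bar>"
  shows "(f has_vector_derivative 0) (at s)"
  unfolding has_vector_derivative_def has_derivative_within
proof
  have "((\<lambda>t. (\<theta> t - \<theta> s) / (t - s)) \<longlongrightarrow> 0) (at s)"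
    using \<theta> by (simp add: has_field_derivative_iff)
  then have lim: "((\<lambda>t. L * \<bar>(\<theta> t - \<theta> s) / (t - s)\<bar>) \<longlongrightarrow> 0) (at s)"
    by (intro tendsto_mult_right_zero tendsto_rabs_zero)
  show "((\<lambda>t. (1 / norm (t - s)) *\<^sub>R (f t - (f s + (t - s) *\<^sub>R 0))) \<longlongrightarrow> 0) (at s)"
  proof (rule Lim_null_comparison[OF _ lim])
    show "\<forall>\<^sub>F t in at s. norm ((1 / norm (t - s)) *\<^sub>R (f t - (f s + (t - s) *\<^sub>R 0)))
        \<le> L * \<bar>(\<theta> t - \<theta> s) / (t - s)\<bar>"
      using bound by eventually_elim (simp add: divide_right_mono abs_divide)
  qed
qed simp

section \<open>Change of time\<close>

lemma DERIV_pos_imp_increasing_up_to: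
  assumes \<theta>: "\<And>t. (\<theta> has_real_derivative \<theta>' t) (at t)" and pos: "\<forall>t<s. \<theta>' t > 0"
    and "t < t'" "t' \<le> s"
  shows "\<theta> t < \<theta> t'"
proof (rule DERIV_pos_imp_increasing_open[OF assms(3) _ continuous_on_if_DERIV[OF \<theta>]])
  fix r assume "t < r" "r < t'"
  then show "\<exists>y. (\<theta> has_real_derivative y) (at r) \<and> 0 < y"
    using \<theta>[of r] pos assms(4) by auto
qed

lemma change_of_variables_increasing:
  fixes g :: "real \<Rightarrow> 'a::euclidean_space"
  assumes \<theta>: "\<And>t. (\<theta> has_real_derivative \<theta>' t) (at t)" and pos: "\<forall>t<m. \<theta>' t > 0"
    and cm: "c < m" and g: "integrable (lebesgue_on {\<theta> c<..<\<theta> m}) g"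
  shows "integrable (lebesgue_on {c<..<m}) (\<lambda>t. \<theta>' t *\<^sub>R g (\<theta> t))"
    and "(\<integral>t. \<theta>' t *\<^sub>R g (\<theta> t) \<partial>lebesgue_on {c<..<m}) = (\<integral>t. g t \<partial>lebesgue_on {\<theta> c<..<\<theta> m})"
proof -
  note mono = DERIV_pos_imp_increasing_up_to[OF \<theta> pos]
  have nonneg: "\<theta>' t \<ge> 0" if "t \<in> {c<..<m}" for t using pos that by auto
  have inj: "inj_on \<theta> {c<..<m}"
  proof (rule inj_onI, rule ccontr)
    fix t t' assume "t \<in> {c<..<m}" "t' \<in> {c<..<m}" "\<theta> t = \<theta> t'" "t \<noteq> t'"
    then show False using mono[of t t'] mono[of t' t] by (cases "t < t'") auto
  qed
  have image: "\<theta> ` {c<..<m} = {\<theta> c<..<\<theta> m}"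
  proof
    show "\<theta> ` {c<..<m} \<subseteq> {\<theta> c<..<\<theta> m}"
    proof (rule image_subsetI)
      fix t assume "t \<in> {c<..<m}"
      then show "\<theta> t \<in> {\<theta> c<..<\<theta> m}" using mono[of c t] mono[of t m] by simp
    qed
    show "{\<theta> c<..<\<theta> m} \<subseteq> \<theta> ` {c<..<m}"
    proof
      fix y assume y: "y \<in> {\<theta> c<..<\<theta> m}"
      obtain t where t: "c \<le> t" "t \<le> m" "\<theta> t = y"
        using IVT'[of \<theta> c y m] y cm continuous_on_if_DERIV[OF \<theta>] by auto
      moreover have "t \<noteq> c" "t \<noteq> m" using t y by auto
      ultimately have "t \<in> {c<..<m}" by simp
      with t(3) show "y \<in> \<theta> ` {c<..<m}" by blast
    qed
  qed
  note * = change_of_variables_lebesgue_on[OF \<theta> nonneg inj image g]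
  show "integrable (lebesgue_on {c<..<m}) (\<lambda>t. \<theta>' t *\<^sub>R g (\<theta> t))"
    "(\<integral>t. \<theta>' t *\<^sub>R g (\<theta> t) \<partial>lebesgue_on {c<..<m}) = (\<integral>t. g t \<partial>lebesgue_on {\<theta> c<..<\<theta> m})"
    using * by auto
qed

text \<open>After time \<open>s\<close> the factor \<open>\<theta>' t\<close> is 0, whatever the
  value of \<open>g\<close> at the resting point, so only the strictly increasing stretch
  contributes.\<close>

lemma change_of_variables_stopped:
  fixes g :: "real \<Rightarrow> 'a::euclidean_space"
  assumes \<theta>: "\<And>t. (\<theta> has_real_derivative \<theta>' t) (at t)"
    and pos: "\<forall>t<s. \<theta>' t > 0" and zero: "\<forall>t\<ge>s. \<theta>' t = 0"
    and cds: "c < s" "s \<le> d" and g: "integrable (lebesgue_on {\<theta> c<..<\<theta> s}) g"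
  shows "integrable (lebesgue_on {c<..<d}) (\<lambda>t. \<theta>' t *\<^sub>R g (\<theta> t))"
    and "(\<integral>t. \<theta>' t *\<^sub>R g (\<theta> t) \<partial>lebesgue_on {c<..<d}) = (\<integral>t. g t \<partial>lebesgue_on {\<theta> c<..<\<theta> s})"
proof -
  have cut: "indicator {c<..<d} t *\<^sub>R \<theta>' t *\<^sub>R g (\<theta> t) = indicator {c<..<s} t *\<^sub>R \<theta>' t *\<^sub>R g (\<theta> t)" for t
    using zero cds by (auto simp: indicator_def)
  note cov = change_of_variables_increasing[OF \<theta> pos cds(1) g]
  show "integrable (lebesgue_on {c<..<d}) (\<lambda>t. \<theta>' t *\<^sub>R g (\<theta> t))"
    using cov(1) by (simp add: integrable_restrict_space cut del: scaleR_scaleR)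
  show "(\<integral>t. \<theta>' t *\<^sub>R g (\<theta> t) \<partial>lebesgue_on {c<..<d}) = (\<integral>t. g t \<partial>lebesgue_on {\<theta> c<..<\<theta> s})"
    using cov(2) by (simp add: integral_restrict_space cut del: scaleR_scaleR)
qed

text \<open>A pointwise chain rule makes no sense for a weak derivative. Instead \<open>f\<close> is
  written as an indefinite integral of \<open>g\<close>, the integral is substituted, and the
  resulting indefinite integral is recognised as having a weak derivative.\<close>

lemma weak_deriv_compose_stopped:
  fixes f g :: "real \<Rightarrow> 'a::euclidean_space"
  assumes \<theta>: "\<And>t. (\<theta> has_real_derivative \<theta>' t) (at t)"
    and pos: "\<forall>t<s. \<theta>' t > 0" and zero: "\<forall>t\<ge>s. \<theta>' t = 0"
    and const: "\<forall>t\<ge>s. \<theta> t = \<theta> s" and cds: "c < s" "s \<le> d"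
    and f: "continuous_on {\<theta> c..\<theta> s} f" and g: "integrable (lebesgue_on {\<theta> c<..<\<theta> s}) g"
    and weak: "is_weak_deriv (\<theta> c) (\<theta> s) f g"
  shows "is_weak_deriv c d (\<lambda>t. f (\<theta> t)) (\<lambda>t. \<theta>' t *\<^sub>R g (\<theta> t))"
proof (rule weak_deriv_indefinite_integral
    [OF _ change_of_variables_stopped(1)[OF \<theta> pos zero cds g]])
  show "c \<le> d" using cds by simp
  note mono = DERIV_pos_imp_increasing_up_to[OF \<theta> pos]
  fix t assume t: "t \<in> {c<..<d}"
  \<comment> \<open>Substitution needs strict monotonicity, so the integral is cut off at the
    stopping time; beyond it \<theta> keeps its value and nothing is lost.\<close>
  define m where "m = min t s"
  have m: "c < m" "m \<le> s" "m \<le> d" "\<theta> m = \<theta> t"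
    using t cds const[rule_format, of t] by (auto simp: m_def min_def)
  have \<theta>m: "\<theta> m \<le> \<theta> s" using mono[of m s] m by (cases "m = s") auto
  have "(\<integral>r. indicator {c<..<t} r *\<^sub>R \<theta>' r *\<^sub>R g (\<theta> r) \<partial>lebesgue_on {c<..<d})
      = (\<integral>r. indicator {c<..<m} r *\<^sub>R \<theta>' r *\<^sub>R g (\<theta> r) \<partial>lebesgue_on {c<..<d})"
    by (intro Bochner_Integration.integral_cong) (auto simp: indicator_def m_def zero)
  also have "\<dots> = (\<integral>r. \<theta>' r *\<^sub>R g (\<theta> r) \<partial>lebesgue_on {c<..<m})"
    using m by (intro integral_indicator_Ioo) auto
  also have "\<dots> = (\<integral>r. g r \<partial>lebesgue_on {\<theta> c<..<\<theta> m})"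
    using m pos
    by (intro change_of_variables_increasing(2)[OF \<theta>] integrable_lebesgue_on_Ioo_mono[OF g \<theta>m]) auto
  also have "\<dots> = (\<integral>r. indicator {\<theta> c<..<\<theta> t} r *\<^sub>R g r \<partial>lebesgue_on {\<theta> c<..<\<theta> s})"
    using \<theta>m m(4) by (simp add: integral_indicator_Ioo)
  also have "\<dots> = f (\<theta> t) - f (\<theta> c)"
    using mono[of c m] m \<theta>m by (intro weak_deriv_FTC[OF f g weak, symmetric]) auto
  finally show "f (\<theta> t) = f (\<theta> c) + (\<integral>r. indicator {c<..<t} r *\<^sub>R \<theta>' r *\<^sub>R g (\<theta> r) \<partial>lebesgue_on {c<..<d})"
    by simp
qed

section \<open>The ReLU system and the training error\<close>

lemma relu_scaleR: "c \<ge> 0 \<Longrightarrow> relu (c *\<^sub>R v) = c *\<^sub>R relu v"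
  by (simp add: relu_def vec_eq_iff max_mult_distrib_left)

lemma relu_of_nonneg: "(\<And>k. v $ k \<ge> 0) \<Longrightarrow> relu v = v"
  by (simp add: relu_def vec_eq_iff)

lemma continuous_on_relu: "continuous_on A f \<Longrightarrow> continuous_on A (\<lambda>t. relu (f t))"
  unfolding relu_def by (intro continuous_intros)

text \<open>Velocities are values of the ReLU, so each coordinate is nondecreasing in time and
  inherits the sign of its initial value.\<close>

lemma relu_system_nonneg:
  assumes sys: "relu_system T u x0 x" and T: "T \<ge> 0" and x0: "x0 i $ k \<ge> 0"
  shows "x i T $ k \<ge> 0"
proof -
  have "x i 0 $ k \<le> x i T $ k"
  proof (rule DERIV_nonneg_imp_increasing_open[OF T])
    fix t assume "0 < t" "t < T"
    then have "(x i has_vector_derivative relu (fst (u t) *v x i t + snd (u t))) (at t)"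
      using sys by (simp add: relu_system_def)
    then have "((\<lambda>t. x i t $ k) has_vector_derivative relu (fst (u t) *v x i t + snd (u t)) $ k) (at t)"
      by (rule bounded_linear.has_vector_derivative[OF bounded_linear_vec_nth])
    then show "\<exists>y. ((\<lambda>t. x i t $ k) has_real_derivative y) (at t) \<and> 0 \<le> y"
      by (auto simp: has_real_derivative_iff_has_vector_derivative relu_def)
  next
    show "continuous_on {0..T} (\<lambda>t. x i t $ k)"
      using sys by (intro continuous_intros) (simp add: relu_system_def)
  qed
  with x0 sys show ?thesis by (simp add: relu_system_def)
qed

text \<open>The velocity is continuous on a compact interval and hence bounded. Only increments up
  to the final time are estimated, because that is where the slowed trajectory stops.\<close>

lemma relu_system_lipschitz:
  assumes sys: "relu_system T u x0 x" and u: "continuous_on {0..T} u"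
  obtains L where "\<And>s. s \<in> {0..T} \<Longrightarrow> norm (x i s - x i T) \<le> L * \<bar>s - T\<bar>"
proof -
  have x: "continuous_on {0..T} (x i)" using sys by (simp add: relu_system_def)
  have "continuous_on {0..T} (\<lambda>t. relu (fst (u t) *v x i t + snd (u t)))"
    unfolding matrix_vector_mult_def by (intro continuous_on_relu continuous_intros u x)
  from continuous_on_Icc_bounded[OF this]
  obtain L where L: "\<And>t. t \<in> {0..T} \<Longrightarrow> norm (relu (fst (u t) *v x i t + snd (u t))) \<le> L" by blast
  have "norm (x i s - x i T) \<le> L * \<bar>s - T\<bar>" if s: "s \<in> {0..T}" for s
  proof (cases "s = T")
    case False
    then have "s < T" using s by simp
    moreover have "continuous_on {s..T} (x i)" using s by (intro continuous_on_subset[OF x]) auto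
    moreover have "(x i has_derivative (\<lambda>h. h *\<^sub>R relu (fst (u t) *v x i t + snd (u t)))) (at t)"
      if "s < t" "t < T" for t
      using sys that s by (simp add: relu_system_def has_vector_derivative_def)
    ultimately obtain t where t: "t \<in> {s<..<T}"
      "norm (x i T - x i s) \<le> norm ((T - s) *\<^sub>R relu (fst (u t) *v x i t + snd (u t)))"
      using mvt_general[of s T "x i" "\<lambda>t h. h *\<^sub>R relu (fst (u t) *v x i t + snd (u t))"] by blast
    note t(2)
    also have "\<dots> \<le> L * \<bar>s - T\<bar>"
      using L[of t] t(1) s by (auto simp: mult.commute intro!: mult_right_mono)
    finally show ?thesis by (simp add: norm_minus_commute)
  qed simp
  with that show ?thesis by blast
qed

text \<open>A nonnegative factor is monotone and so commutes with \<open>Max\<close>. With at least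
  two classes the maximum runs over a nonempty set, as this commutation requires.\<close>

lemma class_gap_scaleR:
  fixes P :: "real^'d^'m::finite"
  assumes "CARD('m) \<ge> 2" "c \<ge> 0"
  shows "class_gap P (c *\<^sub>R z) k = c * class_gap P z k"
proof -
  have "{j. j \<noteq> k} \<noteq> {}"
  proof
    assume "{j. j \<noteq> k} = {}"
    then have "(UNIV :: 'm set) = {k}" by auto
    then have "CARD('m) = 1" by (metis card_1_singleton_iff One_nat_def)
    with assms show False by simp
  qed
  then have "c * Max ((\<lambda>j. (P *v z) $ j) ` {j. j \<noteq> k}) = Max ((*) c ` ((\<lambda>j. (P *v z) $ j) ` {j. j \<noteq> k}))"
    using assms by (intro mono_Max_commute) (auto simp: mono_def mult_left_mono)
  then show ?thesis
    by (simp add: class_gap_def matrix_vector_mult_scaleR image_image right_diff_distrib)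
qed

text \<open>After division by the exponential of the correct class, the softmax denominator is 1
  plus m - 1 terms, each at most \<open>exp (- M)\<close>. The bound holds for each sample and so
  for their mean.\<close>

lemma training_error_le:
  fixes P :: "real^('d::finite)^('m::finite)" and y :: "'n::finite \<Rightarrow> 'm"
  assumes "\<And>i. class_gap P (z i) (y i) \<ge> M"
  shows "training_error P y z \<le> ln (1 + (real CARD('m) - 1) * exp (- M))"
proof -
  have "- ln (exp ((P *v z i) $ y i) / (\<Sum>j\<in>UNIV. exp ((P *v z i) $ j)))
      \<le> ln (1 + (real CARD('m) - 1) * exp (- M))" for i
  proof -
    let ?p = "\<lambda>j. (P *v z i) $ j"
    have pos: "(\<Sum>j\<in>UNIV. exp (?p j)) > 0" by (rule sum_pos) auto
    have "- ln (exp (?p (y i)) / (\<Sum>j\<in>UNIV. exp (?p j))) = ln ((\<Sum>j\<in>UNIV. exp (?p j)) / exp (?p (y i)))"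
      using pos by (simp add: ln_div)
    also have "(\<Sum>j\<in>UNIV. exp (?p j)) / exp (?p (y i)) = (\<Sum>j\<in>UNIV. exp (?p j - ?p (y i)))"
      by (simp add: sum_divide_distrib exp_diff)
    also have "\<dots> = 1 + (\<Sum>j\<in>UNIV - {y i}. exp (?p j - ?p (y i)))"
      by (subst sum.remove[of _ "y i"]) auto
    also have "ln \<dots> \<le> ln (1 + (real CARD('m) - 1) * exp (- M))"
    proof -
      have "exp (?p j - ?p (y i)) \<le> exp (- M)" if "j \<in> UNIV - {y i}" for j
      proof -
        have "?p j \<le> Max (?p ` {j. j \<noteq> y i})" using that by (intro Max_ge) auto
        then show ?thesis using assms[of i] by (simp add: class_gap_def)
      qed
      then have "(\<Sum>j\<in>UNIV - {y i}. exp (?p j - ?p (y i))) \<le> real (card (UNIV - {y i})) * exp (- M)"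
        by (intro sum_bounded_above)
      also have "real (card (UNIV - {y i})) = real CARD('m) - 1"
        by (simp add: card_Diff_singleton of_nat_diff Suc_le_eq)
      finally have le: "(\<Sum>j\<in>UNIV - {y i}. exp (?p j - ?p (y i))) \<le> (real CARD('m) - 1) * exp (- M)" .
      have "(\<Sum>j\<in>UNIV - {y i}. exp (?p j - ?p (y i))) \<ge> 0" by (rule sum_nonneg) simp
      with le show ?thesis by (intro ln_mono) auto
    qed
    finally show ?thesis .
  qed
  then have "(\<Sum>i\<in>UNIV. - ln (exp ((P *v z i) $ y i) / (\<Sum>j\<in>UNIV. exp ((P *v z i) $ j))))
      \<le> real CARD('n) * ln (1 + (real CARD('m) - 1) * exp (- M))"
    by (rule sum_bounded_above)
  then show ?thesis
    unfolding training_error_def by (simp add: field_simps)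
qed

lemma has_real_derivative_pos_part_affine:
  "((\<lambda>t. max 0 (c * t + d) ^ Suc (Suc n)) has_real_derivative
     real (n + 2) * max 0 (c * t + d) ^ Suc n * c) (at t)"
  by (rule DERIV_chain2[where f = "\<lambda>x. max 0 x ^ Suc (Suc n)" and g = "\<lambda>t. c * t + d",
        OF has_real_derivative_pos_part_power]) (auto intro!: derivative_eq_intros)

section \<open>The competitor\<close>

text \<open>The trajectory of the competitor is written down and verified, so no existence theorem
  for the system is invoked. Nonnegativity is needed only at \<open>T0\<close>, where the expansion
  starts. The factors 2 and 4 in the bound come from one or two applications of the estimate of a
  squared sum by twice the sum of squares.\<close>

lemma exists_scaled_solution:
  fixes u0 :: "real \<Rightarrow> ('d::finite) param" and x0 :: "'n \<Rightarrow> real^'d"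
  assumes T0: "T0 > 0" and S: "0 < S" "S \<le> T" and A: "A \<ge> 0"
    and u0: "continuous_on {0..T0} u0" and B: "\<And>t. t \<in> {0..T0} \<Longrightarrow> norm (u0 t) \<le> B"
    and g: "square_integrable 0 T0 g" "is_weak_deriv 0 T0 u0 g"
    and sys: "relu_system T0 u0 x0 z0" and nonneg: "\<And>i k. z0 i T0 $ k \<ge> 0"
  defines "I \<equiv> (mat 1, 0) :: 'd param"
  obtains v x where "v \<in> H1 0 T" "relu_system T v x0 x"
    "\<And>i. x i T = exp (A * (T - S) ^ 3 / 3) *\<^sub>R z0 i T0"
    "(H1_norm 0 T v)\<^sup>2 \<le>
       T * (2 * (3 * T0 / S * B)\<^sup>2 + 2 * (A * (T - S)\<^sup>2 * norm I)\<^sup>2 +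
            4 * (6 * T0 / S\<^sup>2 * B)\<^sup>2 + 2 * (2 * A * (T - S) * norm I)\<^sup>2) +
       4 * (3 * T0 / S) ^ 3 * (\<integral>t. (norm (g t))\<^sup>2 \<partial>lebesgue_on {0<..<T0})"
proof -
  \<comment> \<open>The degrees are dictated by regularity: \<open>\<eta>\<close>, the derivative of
    \<theta>, and the expansion rate \<open>c\<close> must both be C1 across \<open>S\<close>, hence
    quadratic in the positive parts \<open>p\<close> and \<open>q\<close>. Their antiderivatives
    \<theta> and \<open>G\<close> are then cubic.\<close>
  define p where "p = (\<lambda>t. max 0 (- 1 / S * t + 1))"
  define \<theta> where "\<theta> = (\<lambda>t. T0 * (1 - p t ^ 3))"
  define \<eta> where "\<eta> = (\<lambda>t. 3 * T0 / S * p t ^ 2)"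
  define \<eta>' where "\<eta>' = (\<lambda>t. - (6 * T0 / S\<^sup>2 * p t))"
  define q where "q = (\<lambda>t. max 0 (1 * t + - S))"
  define c where "c = (\<lambda>t. A * q t ^ 2)"
  define c' where "c' = (\<lambda>t. 2 * A * q t)"
  define G where "G = (\<lambda>t. A * q t ^ 3 / 3)"
  have T: "T > 0" using S by simp
  have Dp3: "((\<lambda>t. p t ^ 3) has_real_derivative 3 * p t ^ 2 * (- 1 / S)) (at t)"
    and Dp2: "((\<lambda>t. p t ^ 2) has_real_derivative 2 * p t * (- 1 / S)) (at t)"
    and Dq3: "((\<lambda>t. q t ^ 3) has_real_derivative 3 * q t ^ 2) (at t)"
    and Dq2: "((\<lambda>t. q t ^ 2) has_real_derivative 2 * q t) (at t)" for t
    unfolding p_def q_def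
    using has_real_derivative_pos_part_affine[of "- 1 / S" 1 1 t]
      has_real_derivative_pos_part_affine[of "- 1 / S" 1 0 t]
      has_real_derivative_pos_part_affine[of 1 "- S" 1 t]
      has_real_derivative_pos_part_affine[of 1 "- S" 0 t]
    by (simp_all add: eval_nat_numeral)
  have D\<theta>: "(\<theta> has_real_derivative \<eta> t) (at t)" for t
    unfolding \<theta>_def \<eta>_def
    by (rule DERIV_cong[OF DERIV_cmult[OF DERIV_diff[OF DERIV_const Dp3]]]) simp
  have D\<eta>: "(\<eta> has_real_derivative \<eta>' t) (at t)" for t
    unfolding \<eta>_def \<eta>'_def
    by (rule DERIV_cong[OF DERIV_cmult[OF Dp2]]) (simp add: power2_eq_square)
  have Dc: "(c has_real_derivative c' t) (at t)" for t
    unfolding c_def c'_def by (rule DERIV_cong[OF DERIV_cmult[OF Dq2]]) simp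
  have DG: "(G has_real_derivative c t) (at t)" for t
    unfolding G_def c_def by (rule DERIV_cong[OF DERIV_cdivide[OF DERIV_cmult[OF Dq3]]]) simp
  have p_eq: "p t = max 0 (1 - t / S)" for t by (simp add: p_def)
  have p_pos: "p t > 0" if "t < S" for t using that S by (simp add: p_eq)
  have p_zero: "p t = 0" if "t \<ge> S" for t using that S by (simp add: p_eq max_def)
  have p_bounds: "0 \<le> p t" "t \<ge> 0 \<Longrightarrow> p t \<le> 1" for t using S by (auto simp: p_eq)
  have q_zero: "q t = 0" if "t \<le> S" for t using that by (simp add: q_def)
  have q_bounds: "0 \<le> q t" "t \<le> T \<Longrightarrow> q t \<le> T - S" for t using S by (auto simp: q_def)
  have \<theta>_ends: "\<theta> 0 = 0" "t \<ge> S \<Longrightarrow> \<theta> t = T0" for t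
    using p_zero by (auto simp: \<theta>_def p_eq)
  have \<theta>_range: "\<theta> t \<in> {0..T0}" if "t \<ge> 0" for t
    using p_bounds[of t] that T0 power_le_one[of "p t" 3] by (auto simp: \<theta>_def mult_le_cancel_left1)
  have \<eta>_bounds: "0 \<le> \<eta> t" "t \<ge> 0 \<Longrightarrow> \<eta> t \<le> 3 * T0 / S" for t
  proof -
    show "0 \<le> \<eta> t" using T0 S by (simp add: \<eta>_def)
    show "\<eta> t \<le> 3 * T0 / S" if "t \<ge> 0"
      unfolding \<eta>_def using p_bounds[of t] that T0 S
      by (intro mult_left_le power_le_one) simp_all
  qed
  have \<eta>'_bound: "\<bar>\<eta>' t\<bar> \<le> 6 * T0 / S\<^sup>2" if "t \<ge> 0" for t
  proof -
    have "\<bar>\<eta>' t\<bar> = 6 * T0 / S\<^sup>2 * p t" using p_bounds(1)[of t] T0 by (simp add: \<eta>'_def abs_mult)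
    also have "\<dots> \<le> 6 * T0 / S\<^sup>2"
      using p_bounds(2)[OF that] T0 S by (intro mult_left_le) simp_all
    finally show ?thesis .
  qed
  have c_bounds: "0 \<le> c t" "t \<le> T \<Longrightarrow> c t \<le> A * (T - S)\<^sup>2" for t
    using q_bounds[of t] A by (auto simp: c_def intro!: mult_left_mono power_mono)
  have c'_bounds: "0 \<le> c' t" "t \<le> T \<Longrightarrow> c' t \<le> 2 * A * (T - S)" for t
    using q_bounds[of t] A by (auto simp: c'_def intro!: mult_left_mono)
  have cont: "continuous_on X p" "continuous_on X q" for X
    unfolding p_def q_def by (intro continuous_intros)+
  have cont_\<theta>: "continuous_on X \<theta>" and cont_\<eta>: "continuous_on X \<eta>" and cont_\<eta>': "continuous_on X \<eta>'"
    and cont_c: "continuous_on X c" and cont_c': "continuous_on X c'" and cont_G: "continuous_on X G" for X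
    unfolding \<theta>_def \<eta>_def \<eta>'_def c_def c'_def G_def using S(1) by (auto intro!: continuous_intros cont)

  define v where "v = (\<lambda>t. \<eta> t *\<^sub>R u0 (\<theta> t) + c t *\<^sub>R I)"
  define h where "h = (\<lambda>t. \<eta> t *\<^sub>R g (\<theta> t))"
  define w where "w = (\<lambda>t. (\<eta>' t *\<^sub>R u0 (\<theta> t) + \<eta> t *\<^sub>R h t) + c' t *\<^sub>R I)"
  define x where "x = (\<lambda>i t. exp (G t) *\<^sub>R z0 i (\<theta> t))"
  let ?M = "lebesgue_on {0<..<T}"
  interpret finite_measure ?M by (rule finite_measure_lebesgue_on) simp

  have pos: "\<forall>t<S. \<eta> t > 0"
  proof (intro allI impI)
    fix t assume "t < S"
    from p_pos[OF this] show "\<eta> t > 0" using T0 S by (simp add: \<eta>_def)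
  qed
  have zero: "\<forall>t\<ge>S. \<eta> t = 0" using p_zero by (simp add: \<eta>_def)
  note g_int = integrable_if_square_integrable[OF g(1)]
  have \<theta>_0: "\<theta> 0 = 0" and \<theta>_S: "\<theta> S = T0" and const: "\<forall>t\<ge>S. \<theta> t = \<theta> S"
    using \<theta>_ends by auto
  note stopped = change_of_variables_stopped[OF D\<theta> pos zero S, unfolded \<theta>_0 \<theta>_S]
  have h_int: "integrable ?M h" unfolding h_def by (rule stopped(1)[OF g_int])
  have weak_u\<theta>: "is_weak_deriv 0 T (\<lambda>t. u0 (\<theta> t)) h"
    unfolding h_def
    by (rule weak_deriv_compose_stopped[OF D\<theta> pos zero const S, unfolded \<theta>_0 \<theta>_S, OF u0 g_int g(2)])
  have "integrable (lebesgue_on {0<..<T0}) (\<lambda>t. (norm (g t))\<^sup>2)"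
    using g(1) by (simp add: square_integrable_def)
  note cov = stopped[OF this]
  have \<theta>_image: "\<theta> ` {0..T} \<subseteq> {0..T0}" by (rule image_subsetI, rule \<theta>_range) simp
  have cont_u\<theta>: "continuous_on {0..T} (\<lambda>t. u0 (\<theta> t))"
    by (rule continuous_on_compose2[OF u0 cont_\<theta> \<theta>_image])
  have cont_v: "continuous_on {0..T} v"
    unfolding v_def
    by (intro continuous_on_add continuous_on_scaleR continuous_on_const cont_u\<theta> cont_\<eta> cont_c)
  \<comment> \<open>The square carries four factors \<open>\<eta>\<close>. One is kept for the
    change of variables, which turns
    \<open>\<eta> t *\<^sub>R (norm (g (\<theta> t)))\<^sup>2\<close> into the integral over (0,
    T0); the other three are bounded by \<open>3 * T0 / S\<close>.\<close>
  have \<eta>h: "(norm (\<eta> t *\<^sub>R h t))\<^sup>2 \<le> (3 * T0 / S) ^ 3 * (\<eta> t *\<^sub>R (norm (g (\<theta> t)))\<^sup>2)" if "t \<ge> 0" for t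
  proof -
    have "norm (\<eta> t *\<^sub>R h t) = \<eta> t * \<eta> t * norm (g (\<theta> t))"
      unfolding h_def norm_scaleR abs_of_nonneg[OF \<eta>_bounds(1)] by (rule mult.assoc[symmetric])
    then have "(norm (\<eta> t *\<^sub>R h t))\<^sup>2 = \<eta> t ^ 3 * (\<eta> t *\<^sub>R (norm (g (\<theta> t)))\<^sup>2)"
      unfolding real_scaleR_def power2_eq_square power3_eq_cube by (simp only: ac_simps)
    also have "\<dots> \<le> (3 * T0 / S) ^ 3 * (\<eta> t *\<^sub>R (norm (g (\<theta> t)))\<^sup>2)"
      by (intro mult_right_mono power_mono \<eta>_bounds(2)[OF that])
         (simp_all add: \<eta>_bounds(1))
    finally show ?thesis .
  qed
  have int_bound: "integrable ?M (\<lambda>t. (3 * T0 / S) ^ 3 * (\<eta> t *\<^sub>R (norm (g (\<theta> t)))\<^sup>2))"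
    using cov(1) by (rule integrable_mult_right)
  have int_\<eta>h: "integrable ?M (\<lambda>t. \<eta> t *\<^sub>R h t)"
    by (rule integrable_continuous_scaleR[OF cont_\<eta> h_int])
  have sq_\<eta>h: "square_integrable 0 T (\<lambda>t. \<eta> t *\<^sub>R h t)"
    unfolding square_integrable_def
  proof
    show meas: "(\<lambda>t. \<eta> t *\<^sub>R h t) \<in> borel_measurable ?M" using int_\<eta>h by simp
    show "integrable ?M (\<lambda>t. (norm (\<eta> t *\<^sub>R h t))\<^sup>2)"
    proof (rule Bochner_Integration.integrable_bound[OF int_bound])
      show "AE t in ?M. norm ((norm (\<eta> t *\<^sub>R h t))\<^sup>2) \<le> norm ((3 * T0 / S) ^ 3 * (\<eta> t *\<^sub>R (norm (g (\<theta> t)))\<^sup>2))"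
      proof (rule AE_I2)
        fix t assume "t \<in> space ?M"
        then have "(norm (\<eta> t *\<^sub>R h t))\<^sup>2 \<le> (3 * T0 / S) ^ 3 * (\<eta> t *\<^sub>R (norm (g (\<theta> t)))\<^sup>2)"
          by (intro \<eta>h) simp
        then show "norm ((norm (\<eta> t *\<^sub>R h t))\<^sup>2) \<le> norm ((3 * T0 / S) ^ 3 * (\<eta> t *\<^sub>R (norm (g (\<theta> t)))\<^sup>2))"
          unfolding real_norm_def abs_power2 abs_norm_cancel power2_abs by linarith
      qed
      show "(\<lambda>t. (norm (\<eta> t *\<^sub>R h t))\<^sup>2) \<in> borel_measurable ?M"
        using meas by measurable
    qed
  qed
  have sq1: "square_integrable 0 T (\<lambda>t. \<eta>' t *\<^sub>R u0 (\<theta> t))"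
    by (rule square_integrable_continuous[OF continuous_on_scaleR[OF cont_\<eta>' cont_u\<theta>]])
  have sq2: "square_integrable 0 T (\<lambda>t. c' t *\<^sub>R I)"
    by (rule square_integrable_continuous[OF continuous_on_scaleR[OF cont_c' continuous_on_const]])
  have sq_w: "square_integrable 0 T w"
    unfolding w_def by (intro square_integrable_add sq1 sq2 sq_\<eta>h)
  have weak_v: "is_weak_deriv 0 T v w"
    unfolding v_def w_def
  proof (rule weak_deriv_add)
    show "is_weak_deriv 0 T (\<lambda>t. \<eta> t *\<^sub>R u0 (\<theta> t)) (\<lambda>t. \<eta>' t *\<^sub>R u0 (\<theta> t) + \<eta> t *\<^sub>R h t)"
      by (rule weak_deriv_scaleR[OF cont_u\<theta> h_int weak_u\<theta> D\<eta> cont_\<eta>'])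
    show "integrable ?M (\<lambda>t. \<eta>' t *\<^sub>R u0 (\<theta> t) + \<eta> t *\<^sub>R h t)"
      by (intro integrable_if_square_integrable square_integrable_add sq1 sq_\<eta>h)
    show "integrable ?M (\<lambda>t. c' t *\<^sub>R I)"
      by (rule integrable_if_square_integrable[OF sq2])
    have "((\<lambda>t. c t *\<^sub>R I) has_vector_derivative c' t *\<^sub>R I) (at t within {0..T})" for t
      using has_vector_derivative_at_within[OF
          bounded_linear.has_vector_derivative[OF bounded_linear_scaleR_left]] Dc[of t]
      unfolding has_real_derivative_iff_has_vector_derivative by blast
    then show "is_weak_deriv 0 T (\<lambda>t. c t *\<^sub>R I) (\<lambda>t. c' t *\<^sub>R I)"
      using T by (intro weak_deriv_C1 continuous_on_scaleR[OF cont_c' continuous_on_const]) auto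
  qed (intro continuous_on_scaleR continuous_on_const cont_u\<theta> cont_\<eta> cont_c)+
  have v_H1: "v \<in> H1 0 T" by (rule H1I[OF cont_v sq_w weak_v])

  have v_bound: "(\<integral>t. (norm (v t))\<^sup>2 \<partial>?M) \<le> T * (2 * (3 * T0 / S * B)\<^sup>2 + 2 * (A * (T - S)\<^sup>2 * norm I)\<^sup>2)"
  proof -
    have "(\<integral>t. (norm (v t))\<^sup>2 \<partial>?M) \<le> (\<integral>t. 2 * (3 * T0 / S * B)\<^sup>2 + 2 * (A * (T - S)\<^sup>2 * norm I)\<^sup>2 \<partial>?M)"
    proof (rule integral_mono)
      show "integrable ?M (\<lambda>t. (norm (v t))\<^sup>2)"
        using square_integrable_continuous[OF cont_v] by (simp add: square_integrable_def)
      fix t assume "t \<in> space ?M"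
      then have t: "0 \<le> t" "t \<le> T" by auto
      have "norm (\<eta> t *\<^sub>R u0 (\<theta> t)) \<le> 3 * T0 / S * B"
        unfolding norm_scaleR abs_of_nonneg[OF \<eta>_bounds(1)]
        using \<eta>_bounds(2)[OF t(1)] B[OF \<theta>_range[OF t(1)]] T0 S by (intro mult_mono) auto
      moreover have "norm (c t *\<^sub>R I) \<le> A * (T - S)\<^sup>2 * norm I"
        unfolding norm_scaleR using c_bounds[of t] t by (intro mult_right_mono) auto
      ultimately have "2 * (norm (\<eta> t *\<^sub>R u0 (\<theta> t)))\<^sup>2 + 2 * (norm (c t *\<^sub>R I))\<^sup>2
          \<le> 2 * (3 * T0 / S * B)\<^sup>2 + 2 * (A * (T - S)\<^sup>2 * norm I)\<^sup>2"
        by (intro add_mono mult_left_mono power_mono) auto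
      then show "(norm (v t))\<^sup>2 \<le> 2 * (3 * T0 / S * B)\<^sup>2 + 2 * (A * (T - S)\<^sup>2 * norm I)\<^sup>2"
        unfolding v_def by (rule order_trans[OF power2_norm_add_le])
    qed (rule integrable_const)
    also have "\<dots> = T * (2 * (3 * T0 / S * B)\<^sup>2 + 2 * (A * (T - S)\<^sup>2 * norm I)\<^sup>2)"
      using T by (simp add: measure_restrict_space)
    finally show ?thesis .
  qed
  have w_bound: "(\<integral>t. (norm (w t))\<^sup>2 \<partial>?M) \<le>
      T * (4 * (6 * T0 / S\<^sup>2 * B)\<^sup>2 + 2 * (2 * A * (T - S) * norm I)\<^sup>2) +
      4 * (3 * T0 / S) ^ 3 * (\<integral>t. (norm (g t))\<^sup>2 \<partial>lebesgue_on {0<..<T0})"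
  proof -
    let ?K = "4 * (6 * T0 / S\<^sup>2 * B)\<^sup>2 + 2 * (2 * A * (T - S) * norm I)\<^sup>2"
    let ?f = "\<lambda>t. 4 * ((3 * T0 / S) ^ 3 * (\<eta> t *\<^sub>R (norm (g (\<theta> t)))\<^sup>2))"
    have f: "integrable ?M ?f" using int_bound by (rule integrable_mult_right)
    have "(\<integral>t. (norm (w t))\<^sup>2 \<partial>?M) \<le> (\<integral>t. ?K + ?f t \<partial>?M)"
    proof (rule integral_mono)
      show "integrable ?M (\<lambda>t. (norm (w t))\<^sup>2)" using sq_w by (simp add: square_integrable_def)
      show "integrable ?M (\<lambda>t. ?K + ?f t)"
        by (intro Bochner_Integration.integrable_add integrable_const f)
      fix t assume "t \<in> space ?M"
      then have t: "0 \<le> t" "t \<le> T" by auto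
      have "norm (\<eta>' t *\<^sub>R u0 (\<theta> t)) \<le> 6 * T0 / S\<^sup>2 * B"
        unfolding norm_scaleR using \<eta>'_bound[OF t(1)] B[OF \<theta>_range[OF t(1)]] T0
        by (intro mult_mono) auto
      then have 1: "(norm (\<eta>' t *\<^sub>R u0 (\<theta> t)))\<^sup>2 \<le> (6 * T0 / S\<^sup>2 * B)\<^sup>2" by (intro power_mono) auto
      have "norm (c' t *\<^sub>R I) \<le> 2 * A * (T - S) * norm I"
        unfolding norm_scaleR using c'_bounds[of t] t by (intro mult_right_mono) auto
      then have 2: "(norm (c' t *\<^sub>R I))\<^sup>2 \<le> (2 * A * (T - S) * norm I)\<^sup>2" by (intro power_mono) auto
      have "(norm (w t))\<^sup>2 \<le> 2 * (norm (\<eta>' t *\<^sub>R u0 (\<theta> t) + \<eta> t *\<^sub>R h t))\<^sup>2 + 2 * (norm (c' t *\<^sub>R I))\<^sup>2"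
        unfolding w_def by (rule power2_norm_add_le)
      also have "\<dots> \<le> 2 * (2 * (norm (\<eta>' t *\<^sub>R u0 (\<theta> t)))\<^sup>2 + 2 * (norm (\<eta> t *\<^sub>R h t))\<^sup>2) + 2 * (norm (c' t *\<^sub>R I))\<^sup>2"
        by (intro add_mono mult_left_mono power2_norm_add_le) auto
      also have "\<dots> \<le> ?K + ?f t"
      proof -
        have "2 * (2 * a + 2 * b) + 2 * c \<le> 4 * a' + 2 * c' + 4 * b'"
          if "a \<le> a'" "c \<le> c'" "b \<le> b'" for a b c a' b' c' :: real
          using that by (simp add: algebra_simps)
        from this[OF 1 2 \<eta>h[OF t(1)]] show ?thesis .
      qed
      finally show "(norm (w t))\<^sup>2 \<le> ?K + ?f t" .
    qed
    also have "\<dots> = (\<integral>t. ?K \<partial>?M) + (\<integral>t. ?f t \<partial>?M)"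
      by (rule Bochner_Integration.integral_add[OF integrable_const f])
    also have "(\<integral>t. ?K \<partial>?M) = T * ?K" using T by (simp add: measure_restrict_space)
    also have "(\<integral>t. ?f t \<partial>?M) = 4 * ((3 * T0 / S) ^ 3 * (\<integral>t. \<eta> t *\<^sub>R (norm (g (\<theta> t)))\<^sup>2 \<partial>?M))"
      by (simp only: integral_mult_right_zero)
    finally show ?thesis unfolding cov(2) by (simp only: mult.assoc)
  qed
  have H1_bound: "(H1_norm 0 T v)\<^sup>2 \<le>
       T * (2 * (3 * T0 / S * B)\<^sup>2 + 2 * (A * (T - S)\<^sup>2 * norm I)\<^sup>2 +
            4 * (6 * T0 / S\<^sup>2 * B)\<^sup>2 + 2 * (2 * A * (T - S) * norm I)\<^sup>2) +
       4 * (3 * T0 / S) ^ 3 * (\<integral>t. (norm (g t))\<^sup>2 \<partial>lebesgue_on {0<..<T0})"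
    unfolding H1_norm_eq[OF cont_v sq_w weak_v]
    using add_mono[OF v_bound w_bound] by (simp only: distrib_left add.assoc)

  have x_T: "x i T = exp (A * (T - S) ^ 3 / 3) *\<^sub>R z0 i T0" for i
    using S by (simp add: x_def G_def q_def \<theta>_ends)
  have sys_x: "relu_system T v x0 x"
    unfolding relu_system_def
  proof (intro allI conjI ballI)
    fix i
    have z0_cont: "continuous_on {0..T0} (z0 i)" and z0_0: "z0 i 0 = x0 i"
      and z0_deriv: "\<And>t. t \<in> {0<..<T0} \<Longrightarrow>
        (z0 i has_vector_derivative relu (fst (u0 t) *v z0 i t + snd (u0 t))) (at t)"
      using sys by (auto simp: relu_system_def)
    have "continuous_on {0..T} (\<lambda>t. z0 i (\<theta> t))"
      by (rule continuous_on_compose2[OF z0_cont cont_\<theta> \<theta>_image])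
    then show "continuous_on {0..T} (x i)"
      unfolding x_def by (intro continuous_on_scaleR continuous_on_exp cont_G)
    show "x i 0 = x0 i" using S by (simp add: x_def G_def q_zero \<theta>_ends z0_0)
    fix t assume t: "t \<in> {0<..<T}"
    define k where "k = (if t < S then \<eta> t *\<^sub>R relu (fst (u0 (\<theta> t)) *v z0 i (\<theta> t) + snd (u0 (\<theta> t))) else 0)"
    have z\<theta>: "((\<lambda>t. z0 i (\<theta> t)) has_vector_derivative k) (at t)"
    proof (cases "t < S")
      case True
      have "p t < 1" using t S by (simp add: p_eq)
      then have "p t ^ 3 < 1" using p_bounds(1)[of t] by (simp add: power_less_one_iff)
      then have "\<theta> t \<in> {0<..<T0}" using p_pos[OF True] T0 by (simp add: \<theta>_def)
      from vector_diff_chain_at[OF D\<theta>[unfolded has_real_derivative_iff_has_vector_derivative] z0_deriv[OF this]]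
      show ?thesis using True by (simp add: k_def o_def)
    next
      case False
      \<comment> \<open>From \<open>S\<close> on, \<theta> rests at \<open>T0\<close>, where the
        equation for \<open>z0\<close> gives no derivative. The Lipschitz bound together with
        \<theta>' = 0 still gives derivative 0, also at \<open>S\<close> itself.\<close>
      obtain L where L: "\<And>s. s \<in> {0..T0} \<Longrightarrow> norm (z0 i s - z0 i T0) \<le> L * \<bar>s - T0\<bar>"
        using relu_system_lipschitz[OF sys u0] by blast
      have "((\<lambda>t. z0 i (\<theta> t)) has_vector_derivative 0) (at t)"
      proof (rule has_vector_derivative_zero_dominated)
        show "(\<theta> has_real_derivative 0) (at t)" using D\<theta>[of t] zero False by simp
        have "\<forall>\<^sub>F s in at t. s \<in> {0<..}"
          using t by (intro eventually_at_in_open') auto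
        then show "\<forall>\<^sub>F s in at t. norm (z0 i (\<theta> s) - z0 i (\<theta> t)) \<le> L * \<bar>\<theta> s - \<theta> t\<bar>"
          by eventually_elim (use False L \<theta>_range \<theta>_ends in auto)
      qed
      with False show ?thesis by (simp add: k_def)
    qed
    have expG: "((\<lambda>t. exp (G t)) has_real_derivative exp (G t) * c t) (at t)"
      using DG[of t] by (auto intro!: derivative_eq_intros)
    have Dx: "(x i has_vector_derivative exp (G t) *\<^sub>R k + (exp (G t) * c t) *\<^sub>R z0 i (\<theta> t)) (at t)"
      unfolding x_def by (rule has_vector_derivative_scaleR[OF expG z\<theta>])
    \<comment> \<open>Before \<open>S\<close> there is no expansion, and positive homogeneity moves
      \<open>\<eta> t\<close> out of the ReLU. From \<open>S\<close> on the parameters are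
      \<open>c t\<close> times the identity with zero bias, and on nonnegative states the ReLU acts
      as the identity.\<close>
    have "relu (fst (v t) *v x i t + snd (v t)) = exp (G t) *\<^sub>R k + (exp (G t) * c t) *\<^sub>R z0 i (\<theta> t)"
    proof (cases "t < S")
      case True
      then have "G t = 0" "c t = 0" by (simp_all add: G_def c_def q_zero)
      moreover from this have "fst (v t) *v x i t + snd (v t)
          = \<eta> t *\<^sub>R (fst (u0 (\<theta> t)) *v z0 i (\<theta> t) + snd (u0 (\<theta> t)))"
        by (simp add: v_def x_def scaleR_matrix_vector_assoc[symmetric] scaleR_add_right)
      ultimately show ?thesis using True \<eta>_bounds(1) by (simp add: k_def relu_scaleR)
    next
      case False
      then have "\<theta> t = T0" "\<eta> t = 0" by (simp_all add: \<theta>_ends zero)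
      then have "fst (v t) *v x i t + snd (v t) = (exp (G t) * c t) *\<^sub>R z0 i T0"
        by (simp add: v_def x_def I_def scaleR_matrix_vector_assoc[symmetric] matrix_vector_mult_scaleR mult.commute)
      moreover have "relu ((exp (G t) * c t) *\<^sub>R z0 i T0) = (exp (G t) * c t) *\<^sub>R z0 i T0"
        using nonneg c_bounds(1) by (intro relu_of_nonneg) simp
      ultimately show ?thesis using False \<open>\<theta> t = T0\<close> by (simp add: k_def)
    qed
    with Dx show "(x i has_vector_derivative relu (fst (v t) *v x i t + snd (v t))) (at t)" by simp
  qed
  from that[OF v_H1 sys_x x_T H1_bound] show thesis .
qed

section \<open>Size of the cost and conclusion\<close>

text \<open>To be used with r = T^\<alpha>. Every term has a factor 1/T; further powers 1/T^2 are
  bounded by \<open>1 / T0\<^sup>2\<close>. Terms from the expansion already contain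
  \<open>r\<^sup>2\<close>, whereas those from \<open>u0\<close> do not and receive it through
  \<open>1 \<le> K * r\<^sup>2\<close>, which is why \<open>K\<close> multiplies only them.\<close>

lemma rescaled_cost_bound:
  fixes T T0 B n \<Gamma> r K :: real
  assumes T: "0 < T0" "T0 \<le> T" and \<Gamma>: "\<Gamma> \<ge> 0" and r: "1 \<le> K * r\<^sup>2"
  defines "S \<equiv> T / 2" and "A \<equiv> 12 * r / T ^ 3"
  shows "T * (2 * (3 * T0 / S * B)\<^sup>2 + 2 * (A * (T - S)\<^sup>2 * n)\<^sup>2 +
            4 * (6 * T0 / S\<^sup>2 * B)\<^sup>2 + 2 * (2 * A * (T - S) * n)\<^sup>2) +
       4 * (3 * T0 / S) ^ 3 * \<Gamma>
     \<le> (K * (72 * T0\<^sup>2 * B\<^sup>2 + 2304 * B\<^sup>2 + 864 * T0 * \<Gamma>) + n\<^sup>2 * (18 + 288 / T0\<^sup>2)) * (r\<^sup>2 / T)"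
    (is "?lhs \<le> ?rhs")
proof -
  have "T > 0" using T by simp
  have 1: "3 * T0 / S * B = 6 * T0 * B / T" "6 * T0 / S\<^sup>2 * B = 24 * T0 * B / T\<^sup>2"
    "3 * T0 / S = 6 * T0 / T"
    using \<open>T > 0\<close> by (simp_all add: S_def power2_eq_square)
  have 2: "A * (T - S)\<^sup>2 * n = 3 * r * n / T" "2 * A * (T - S) * n = 12 * r * n / T\<^sup>2"
    using \<open>T > 0\<close> by (simp_all add: S_def A_def field_simps eval_nat_numeral)
  have "?lhs = (72 * T0\<^sup>2 * B\<^sup>2 + 18 * r\<^sup>2 * n\<^sup>2 +
      (2304 * T0\<^sup>2 * B\<^sup>2 + 288 * r\<^sup>2 * n\<^sup>2 + 864 * T0 ^ 3 * \<Gamma>) / T\<^sup>2) / T"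
    unfolding 1 2 using \<open>T > 0\<close> by (simp add: field_simps eval_nat_numeral)
  also have "\<dots> \<le> (72 * T0\<^sup>2 * B\<^sup>2 + 18 * r\<^sup>2 * n\<^sup>2 +
      (2304 * T0\<^sup>2 * B\<^sup>2 + 288 * r\<^sup>2 * n\<^sup>2 + 864 * T0 ^ 3 * \<Gamma>) / T0\<^sup>2) / T"
    using T \<Gamma> by (intro divide_right_mono add_left_mono divide_left_mono power_mono) auto
  also have "\<dots> = (1 * (72 * T0\<^sup>2 * B\<^sup>2 + 2304 * B\<^sup>2 + 864 * T0 * \<Gamma>) +
      n\<^sup>2 * (18 + 288 / T0\<^sup>2) * r\<^sup>2) / T"
    using T by (simp add: field_simps eval_nat_numeral)
  also have "\<dots> \<le> (K * r\<^sup>2 * (72 * T0\<^sup>2 * B\<^sup>2 + 2304 * B\<^sup>2 + 864 * T0 * \<Gamma>) +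
      n\<^sup>2 * (18 + 288 / T0\<^sup>2) * r\<^sup>2) / T"
    using T \<Gamma> r by (intro divide_right_mono add_right_mono mult_right_mono) auto
  also have "\<dots> = ?rhs" by (simp add: algebra_simps add_divide_distrib)
  finally show ?thesis .
qed

text \<open>If T < 1, then T^\<beta> \<ge> T \<ge> T0 and (1 + 1/T0) T0 = T0 + 1. The exponent used
  is \<beta> = 2\<alpha> < 1, and the factor does not involve it, which makes the final constant
  uniform in \<alpha>.\<close>

lemma one_le_powr_times:
  fixes T T0 \<beta> :: real
  assumes "0 < T0" "T0 \<le> T" "0 \<le> \<beta>" "\<beta> \<le> 1"
  shows "1 \<le> (1 + 1 / T0) * T powr \<beta>"
proof (cases "T \<ge> 1")
  case True
  have "1 * 1 \<le> (1 + 1 / T0) * T powr \<beta>"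
    using assms True by (intro mult_mono ge_one_powr_ge_zero) auto
  then show ?thesis by simp
next
  case False
  have "1 \<le> (1 + 1 / T0) * T0" using assms by (simp add: field_simps)
  also have "\<dots> \<le> (1 + 1 / T0) * T powr 1" using assms by (intro mult_left_mono) auto
  also have "\<dots> \<le> (1 + 1 / T0) * T powr \<beta>"
    using assms False by (intro mult_left_mono powr_mono') auto
  finally show ?thesis .
qed

theorem theorem3p3:
  fixes data :: "'n::finite \<Rightarrow> real^'d::finite"
    and y :: "'n \<Rightarrow> 'm::finite"
    and lam :: real
    and Q :: "real^'d \<Rightarrow> real^'d"
    and x0 :: "'n \<Rightarrow> real^'d"
    and P :: "real^'d^'m"
    and T0 \<gamma> :: real
    and u0 :: "real \<Rightarrow> 'd param"
    and z0 :: "'n \<Rightarrow> real \<Rightarrow> real^'d"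
  assumes "CARD('m) \<ge> 2"
    and "inj data"
    and "lam > 0"
    and "\<exists>A c. \<forall>v. Q v = A *v v + c"
    and "Q \<noteq> (\<lambda>v. 0)"
    and "\<forall>i k. Q (data i) $ k \<ge> 0"
    and "\<forall>i. x0 i = Q (data i)"
    and "P \<noteq> 0"
    and "T0 > 0"
    and "separates_by T0 P x0 y u0 z0"
    and "\<gamma> = margin P y (\<lambda>i. z0 i T0)"
  shows "\<exists>C>0. \<forall>T\<ge>T0. \<forall>u x. global_minimizer lam T P x0 y u x \<longrightarrow>
           (\<forall>\<alpha>. 0 < \<alpha> \<and> \<alpha> < 1/2 \<longrightarrow>
              training_error P y (\<lambda>i. x i T)
                \<le> ln (1 + (real CARD('m) - 1) * exp (- \<gamma> * exp (T powr \<alpha> / 2)))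
                  + C * T powr (2 * \<alpha> - 1))"
proof -
  have H1: "u0 \<in> H1 0 T0" and sys: "relu_system T0 u0 x0 z0"
    using assms(10) by (auto simp: separates_by_def)
  then obtain g where u0: "continuous_on {0..T0} u0"
    and g: "square_integrable 0 T0 g" "is_weak_deriv 0 T0 u0 g"
    by (auto simp: H1_def)
  obtain B where B: "\<And>t. t \<in> {0..T0} \<Longrightarrow> norm (u0 t) \<le> B"
    using continuous_on_Icc_bounded[OF u0] by blast
  have nonneg: "z0 i T0 $ k \<ge> 0" for i k
    using relu_system_nonneg[OF sys, of i k] assms(6,7,9) by simp
  define n where "n = norm ((mat 1, 0) :: 'd param)"
  define \<Gamma> where "\<Gamma> = (\<integral>t. (norm (g t))\<^sup>2 \<partial>lebesgue_on {0<..<T0})"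
  define K where "K = 1 + 1 / T0"
  define C0 where "C0 = K * (72 * T0\<^sup>2 * B\<^sup>2 + 2304 * B\<^sup>2 + 864 * T0 * \<Gamma>) + n\<^sup>2 * (18 + 288 / T0\<^sup>2)"
  have \<Gamma>: "\<Gamma> \<ge> 0" unfolding \<Gamma>_def by simp
  then have C0: "C0 \<ge> 0" unfolding C0_def K_def using assms(9) by simp
  \<comment> \<open>The summand 1 makes the constant positive using only
    \<open>C0 \<ge> 0\<close>.\<close>
  have "training_error P y (\<lambda>i. x i T)
      \<le> ln (1 + (real CARD('m) - 1) * exp (- \<gamma> * exp (T powr \<alpha> / 2))) + (lam * C0 + 1) * T powr (2 * \<alpha> - 1)"
    if T: "T \<ge> T0" and min: "global_minimizer lam T P x0 y u x" and \<alpha>: "0 < \<alpha>" "\<alpha> < 1/2" for T u x \<alpha>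
  proof -
    have "T > 0" using T assms(9) by simp
    \<comment> \<open>With half of the time left for the expansion, 12 is the value for which the
      exponent \<open>A * (T - S) ^ 3 / 3\<close> equals \<open>T powr \<alpha> / 2\<close>.\<close>
    define S where "S = T / 2"
    define A where "A = 12 * T powr \<alpha> / T ^ 3"
    have S: "0 < S" "S \<le> T" and A: "A \<ge> 0" using \<open>T > 0\<close> by (simp_all add: S_def A_def)
    obtain v z where v: "v \<in> H1 0 T" and z: "relu_system T v x0 z"
      and z_T: "\<And>i. z i T = exp (A * (T - S) ^ 3 / 3) *\<^sub>R z0 i T0"
      and cost: "(H1_norm 0 T v)\<^sup>2 \<le> T * (2 * (3 * T0 / S * B)\<^sup>2 + 2 * (A * (T - S)\<^sup>2 * n)\<^sup>2 +
            4 * (6 * T0 / S\<^sup>2 * B)\<^sup>2 + 2 * (2 * A * (T - S) * n)\<^sup>2) + 4 * (3 * T0 / S) ^ 3 * \<Gamma>"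
      unfolding n_def \<Gamma>_def
      using exists_scaled_solution[OF assms(9) S A u0 B g sys nonneg] by blast
    have powr: "(T powr \<alpha>)\<^sup>2 = T powr (2 * \<alpha>)" "T powr (2 * \<alpha>) / T = T powr (2 * \<alpha> - 1)"
      using \<open>T > 0\<close> by (simp_all add: powr_power powr_diff mult.commute)
    note cost
    also have "T * (2 * (3 * T0 / S * B)\<^sup>2 + 2 * (A * (T - S)\<^sup>2 * n)\<^sup>2 +
            4 * (6 * T0 / S\<^sup>2 * B)\<^sup>2 + 2 * (2 * A * (T - S) * n)\<^sup>2) + 4 * (3 * T0 / S) ^ 3 * \<Gamma>
        \<le> C0 * ((T powr \<alpha>)\<^sup>2 / T)"
      unfolding C0_def S_def A_def
    proof (rule rescaled_cost_bound[OF assms(9) T \<Gamma>])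
      show "1 \<le> K * (T powr \<alpha>)\<^sup>2"
        unfolding K_def powr(1) using \<alpha> by (intro one_le_powr_times assms(9) T) auto
    qed
    finally have norm: "(H1_norm 0 T v)\<^sup>2 \<le> C0 * T powr (2 * \<alpha> - 1)" unfolding powr .
    have "A * (T - S) ^ 3 / 3 = T powr \<alpha> / 2"
      using \<open>T > 0\<close> by (simp add: A_def S_def field_simps eval_nat_numeral)
    then have z_T': "z i T = exp (T powr \<alpha> / 2) *\<^sub>R z0 i T0" for i using z_T by simp
    have "\<gamma> * exp (T powr \<alpha> / 2) \<le> class_gap P (z i T) (y i)" for i
    proof -
      have "\<gamma> \<le> class_gap P (z0 i T0) (y i)" unfolding assms(11) margin_def by (intro Min_le) auto
      then show ?thesis unfolding z_T' class_gap_scaleR[OF assms(1) exp_ge_zero] by simp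
    qed
    from training_error_le[OF this]
    have error: "training_error P y (\<lambda>i. z i T)
        \<le> ln (1 + (real CARD('m) - 1) * exp (- \<gamma> * exp (T powr \<alpha> / 2)))" by simp
    \<comment> \<open>The regularization term of the minimizer is nonnegative and is dropped; that
      of the competitor is retained and produces the power of T.\<close>
    have "training_error P y (\<lambda>i. x i T) \<le> J_cost lam T P y u x"
      using assms(3) by (simp add: J_cost_def)
    also have "\<dots> \<le> J_cost lam T P y v z"
      using min v z by (simp add: global_minimizer_def)
    also have "\<dots> \<le> ln (1 + (real CARD('m) - 1) * exp (- \<gamma> * exp (T powr \<alpha> / 2)))
        + lam * (C0 * T powr (2 * \<alpha> - 1))"
      unfolding J_cost_def using error norm assms(3) by (intro add_mono mult_left_mono) auto
    also have "\<dots> \<le> ln (1 + (real CARD('m) - 1) * exp (- \<gamma> * exp (T powr \<alpha> / 2)))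
        + (lam * C0 + 1) * T powr (2 * \<alpha> - 1)"
      by (simp add: distrib_right)
    finally show ?thesis .
  qed
  moreover have "lam * C0 + 1 > 0" using C0 assms(3) by (simp add: add_nonneg_pos)
  ultimately show ?thesis by blast
qed

end
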